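(* Class tables of the non-contravariant type system with single instantiation inheritance describe exactly the deterministic context-free forests: $\mathcal{L}(\mathcal{T}_{\{X\}})=\mathrm{DCF}$.
   Context: Terms. A ranked alphabet is a finite set of symbols, each with a rank in $\mathbb{N}$; $A^{\triangle}$ is the set of finite ground terms (trees) over a ranked alphabet $A$. $X$ is a set of parameters (rank $0$), disjoint from other alphabets; $\tau[\boldsymbol{x}\leftarrow\boldsymbol{t}]$ is simultaneous substitution. Class tables without contravariance. A class table $\Delta$ over a finite set of class names $\Gamma$ consists of one declaration $\gamma(\diamond_1x_1,\dots,\diamond_kx_k):\tau_1,\dots,\tau_m$ ($k,m\ge 0$) for each $\gamma\in\Gamma$, where $k$ is the rank of $\gamma$, the $x_i\in X$ are distinct, $\diamond_i$ is the variance of the $i$-th parameter of $\gamma$, denoted $\mathrm{var}_i(\gamma)$, and the supertypes $\tau_j$ are terms over $\Gamma\cup\{x_1,\dots,x_k\}$, none of which is itself a parameter. In general variances are $\circ$ (invariant), $+$ (covariant) or $-$ (contravariant); in a non-contravariant table all variances are in $\{\circ,+\}$. Ground types are elements of $\Gamma^{\triangle}$. We write $\gamma(\boldsymbol{x}):\tau$ if $\tau$ is one of the declared supertypes of $\gamma$. Inheritance. $\gamma(\boldsymbol{t})\rightarrowtail\tau[\boldsymbol{x}\leftarrow\boldsymbol{t}]$ whenever $\gamma(\boldsymbol{x}):\tau$. Class inheritance closure $:^*$ is the least relation with $\gamma(\boldsymbol{x}):^*\gamma(\boldsymbol{x})$, and $\gamma(\boldsymbol{x}):^*\tau[\boldsymbol{x}'\leftarrow\boldsymbol{\tau}]$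 whenever $\gamma(\boldsymbol{x}):\gamma'(\boldsymbol{\tau})$ and $\gamma'(\boldsymbol{x}'):^*\tau$; $:^+$ and $\rightarrowtail^+$ are the transitive, non-reflexive versions (one or more steps). Subtyping. $<:$ is the least relation on ground types closed under: (Var) $\gamma(t_1,\dots,t_k)<:\gamma(t_1',\dots,t_k')$ if for every $i$: $t_i<:t_i'$ when $\mathrm{var}_i(\gamma)=+$, $t_i=t_i'$ when $\mathrm{var}_i(\gamma)=\circ$ (and $t_i'<:t_i$ when $\mathrm{var}_i(\gamma)=-$); (Super) $t<:t''$ if $t\rightarrowtail t'$ and $t'<:t''$. Well-formedness. $\Delta$ is well-formed if (acyclic inheritance) $\gamma(\boldsymbol{\tau})\rightarrowtail^+\gamma'(\boldsymbol{\tau}')$ implies $\gamma\ne\gamma'$; and (valid variance) for each declaration $\gamma(\boldsymbol{\diamond x}):\tau_1,\dots,\tau_m$, $\boldsymbol{\diamond x}\vdash\tau_j$ for all $j$, where $\boldsymbol{\diamond x}\vdash x_i$ iff $\diamond_i\in\{\circ,+\}$, and $\boldsymbol{\diamond x}\vdash\gamma'(\tau'_1,\dots,\tau'_n)$ iff for all $i$: $\mathrm{var}_i(\gamma')\in\{\circ,+\}$ implies $\boldsymbol{\diamond x}\vdash\tau'_i$, and $\mathrm{var}_i(\gamma')\in\{\circ,-\}$ implies $\neg\boldsymbol{\diamond x}\vdash\tau'_i$; here $\neg\boldsymbol{\diamond x}$ swaps $+$ and $-$ and leaves $\circ$ fixed. Type system $\mathcal{T}_{\{X\}}$. A class table $\Delta$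 conforms to $\mathcal{T}_{\{X\}}$, written $\mathcal{T}_{\{X\}}\vdash\Delta$, if it is well-formed, no parameter of any class is contravariant, and it has single instantiation inheritance, i.e., $\gamma(\boldsymbol{x}):^+\gamma'(\boldsymbol{\tau})$ and $\gamma(\boldsymbol{x}):^+\gamma'(\boldsymbol{\tau}')$ imply $\boldsymbol{\tau}=\boldsymbol{\tau}'$. (Expansive inheritance is allowed.) Languages. For a class table $\Delta$ over $\Gamma$, a ground type $t_\bot\in\Gamma^{\triangle}$ and a super-alphabet $\Sigma_\top\subseteq\Gamma$, $L_{t_\bot}(\Delta)=\{t_\top\in\Sigma_\top^{\triangle}\mid t_\bot<:t_\top\}$. $\mathcal{L}(\mathcal{T}_{\{X\}})$ is the class of all forests $L_{t_\bot}(\Delta)$ with $\mathcal{T}_{\{X\}}\vdash\Delta$ (over all choices of $\Gamma,\Delta,t_\bot,\Sigma_\top$). Deterministic context-free forests. A context-free tree grammar in Greibach normal form (GNF) is $G=\langle\Sigma,V,v_0,R\rangle$ with $\Sigma$ a finite ranked alphabet, $V$ a finite ranked set of variables disjoint from $\Sigma$, $v_0\in V$ of rank $0$, and $R$ a finite set of productions $v(x_1,\dots,x_k)::=\sigma(\tau_1,\dots,\tau_n)$ with $v\in V$ of rank $k$, distinct parameters $x_i$, $\sigma\in\Sigma$ of rank $n$, and $\tau_j$ terms over $\Sigma\cup V\cup\{x_1,\dots,x_k\}$. It is deterministic if whenever $v(\boldsymbol{x})::=\sigma(\boldsymbol{\tau})$ and $v(\boldsymbol{x})::=\sigma(\boldsymbol{\tau}')$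 are both in $R$, $\boldsymbol{\tau}=\boldsymbol{\tau}'$ (where each variable $v$ uses the same parameter names in all of its productions). One derivation step $t\to_Gt'$ replaces one subtree $v(t_1,\dots,t_k)$ of $t\in(\Sigma\cup V)^{\triangle}$ by $\tau[x_1\leftarrow t_1,\dots,x_k\leftarrow t_k]$ for a production $v(x_1,\dots,x_k)::=\tau$; $L(G)=\{t\in\Sigma^{\triangle}\mid v_0\to_G^*t\}$. DCF is the class of forests $L(G)$, $G$ a deterministic context-free tree grammar in GNF. *)

theory Defs
  imports Main
begin

section \<open>Terms over ranked alphabets\<close>

text \<open>Parameters have a constructor of their own, hence are disjoint from every alphabet;
  natural numbers serve as their names.\<close>

type_synonym param = nat

datatype 'a trm = Par param | App 'a "'a trm list"

text \<open>\<open>terms A rk P\<close> is the set of finite, correctly ranked terms over \<open>A \<union> P\<close>, where \<open>P\<close> is a set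
  of parameters and \<open>rk\<close> gives the ranks of the symbols in \<open>A\<close>.\<close>

inductive_set terms :: "'a set \<Rightarrow> ('a \<Rightarrow> nat) \<Rightarrow> param set \<Rightarrow> 'a trm set"
  for A :: "'a set" and rk :: "'a \<Rightarrow> nat" and P :: "param set" where
  Par: "x \<in> P \<Longrightarrow> Par x \<in> terms A rk P"
| App: "\<lbrakk>f \<in> A; length ts = rk f; \<forall>t\<in>set ts. t \<in> terms A rk P\<rbrakk> \<Longrightarrow> App f ts \<in> terms A rk P"

abbreviation ground :: "'a set \<Rightarrow> ('a \<Rightarrow> nat) \<Rightarrow> 'a trm set" where
  "ground A rk \<equiv> terms A rk {}"

primrec subst :: "(param \<Rightarrow> 'a trm) \<Rightarrow> 'a trm \<Rightarrow> 'a trm" where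
  "subst s (Par x) = s x"
| "subst s (App f ts) = App f (map (subst s) ts)"

text \<open>\<open>inst xs ts \<tau>\<close> is the simultaneous substitution \<open>\<tau>[xs \<leftarrow> ts]\<close>.\<close>

definition inst :: "param list \<Rightarrow> 'a trm list \<Rightarrow> 'a trm \<Rightarrow> 'a trm" where
  "inst xs ts = subst (\<lambda>x. case map_of (zip xs ts) x of None \<Rightarrow> Par x | Some t \<Rightarrow> t)"


section \<open>Class tables\<close>

datatype variance = Invariant | Covariant | Contravariant

fun neg_var :: "variance \<Rightarrow> variance" where
  "neg_var Invariant = Invariant"
| "neg_var Covariant = Contravariant"
| "neg_var Contravariant = Covariant"

text \<open>The declaration \<open>\<gamma>(\<diamond>\<^sub>1 x\<^sub>1, \<dots>, \<diamond>\<^sub>k x\<^sub>k) : \<tau>\<^sub>1, \<dots>, \<tau>\<^sub>m\<close> of a class \<open>\<gamma>\<close> is given by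
  \<open>header \<Delta> \<gamma> = [(\<diamond>\<^sub>1, x\<^sub>1), \<dots>, (\<diamond>\<^sub>k, x\<^sub>k)]\<close> and \<open>supers \<Delta> \<gamma> = [\<tau>\<^sub>1, \<dots>, \<tau>\<^sub>m]\<close>.
  The values of these functions outside \<open>classes \<Delta>\<close> are irrelevant.\<close>

record 'a class_table =
  classes :: "'a set"
  header :: "'a \<Rightarrow> (variance \<times> param) list"
  supers :: "'a \<Rightarrow> 'a trm list"

definition params :: "'a class_table \<Rightarrow> 'a \<Rightarrow> param list" where
  "params \<Delta> \<gamma> = map snd (header \<Delta> \<gamma>)"

definition crank :: "'a class_table \<Rightarrow> 'a \<Rightarrow> nat" where
  "crank \<Delta> \<gamma> = length (header \<Delta> \<gamma>)"

text \<open>Argument positions are counted from 0.\<close>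

definition var :: "'a class_table \<Rightarrow> 'a \<Rightarrow> nat \<Rightarrow> variance" where
  "var \<Delta> \<gamma> i = fst (header \<Delta> \<gamma> ! i)"

definition class_table :: "'a class_table \<Rightarrow> bool" where
  "class_table \<Delta> \<longleftrightarrow> finite (classes \<Delta>) \<and>
     (\<forall>\<gamma>\<in>classes \<Delta>. distinct (params \<Delta> \<gamma>) \<and>
        (\<forall>\<tau>\<in>set (supers \<Delta> \<gamma>).
           \<tau> \<in> terms (classes \<Delta>) (crank \<Delta>) (set (params \<Delta> \<gamma>)) \<and> (\<forall>x. \<tau> \<noteq> Par x)))"

abbreviation ground_types :: "'a class_table \<Rightarrow> 'a trm set" where
  "ground_types \<Delta> \<equiv> ground (classes \<Delta>) (crank \<Delta>)"

text \<open>One inheritance step. It is defined on arbitrary terms over the classes and the parameters;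
  a step from a ground type leads to a ground type.\<close>

inductive inherits :: "'a class_table \<Rightarrow> 'a trm \<Rightarrow> 'a trm \<Rightarrow> bool" for \<Delta> :: "'a class_table" where
  "\<lbrakk>App \<gamma> ts \<in> terms (classes \<Delta>) (crank \<Delta>) UNIV; \<tau> \<in> set (supers \<Delta> \<gamma>)\<rbrakk>
   \<Longrightarrow> inherits \<Delta> (App \<gamma> ts) (inst (params \<Delta> \<gamma>) ts \<tau>)"

text \<open>\<open>inh_star \<Delta> \<gamma> \<tau>\<close> and \<open>inh_plus \<Delta> \<gamma> \<tau>\<close> stand for \<open>\<gamma>(x) :\<^sup>* \<tau>\<close> and \<open>\<gamma>(x) :\<^sup>+ \<tau>\<close>, where \<open>x\<close> are the
  declared parameters of \<open>\<gamma>\<close>.\<close>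

inductive inh_star :: "'a class_table \<Rightarrow> 'a \<Rightarrow> 'a trm \<Rightarrow> bool" for \<Delta> :: "'a class_table" where
  refl: "\<gamma> \<in> classes \<Delta> \<Longrightarrow> inh_star \<Delta> \<gamma> (App \<gamma> (map Par (params \<Delta> \<gamma>)))"
| step: "\<lbrakk>\<gamma> \<in> classes \<Delta>; App \<gamma>' \<tau>s \<in> set (supers \<Delta> \<gamma>); inh_star \<Delta> \<gamma>' \<tau>\<rbrakk>
   \<Longrightarrow> inh_star \<Delta> \<gamma> (inst (params \<Delta> \<gamma>') \<tau>s \<tau>)"

inductive inh_plus :: "'a class_table \<Rightarrow> 'a \<Rightarrow> 'a trm \<Rightarrow> bool" for \<Delta> :: "'a class_table" where
  "\<lbrakk>\<gamma> \<in> classes \<Delta>; App \<gamma>' \<tau>s \<in> set (supers \<Delta> \<gamma>); inh_star \<Delta> \<gamma>' \<tau>\<rbrakk>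
   \<Longrightarrow> inh_plus \<Delta> \<gamma> (inst (params \<Delta> \<gamma>') \<tau>s \<tau>)"

inductive subtype :: "'a class_table \<Rightarrow> 'a trm \<Rightarrow> 'a trm \<Rightarrow> bool" for \<Delta> :: "'a class_table" where
  Var: "\<lbrakk>App \<gamma> ts \<in> ground_types \<Delta>; App \<gamma> ts' \<in> ground_types \<Delta>;
     \<forall>i < crank \<Delta> \<gamma>.
       (var \<Delta> \<gamma> i = Covariant \<longrightarrow> subtype \<Delta> (ts ! i) (ts' ! i)) \<and>
       (var \<Delta> \<gamma> i = Invariant \<longrightarrow> ts ! i = ts' ! i) \<and>
       (var \<Delta> \<gamma> i = Contravariant \<longrightarrow> subtype \<Delta> (ts' ! i) (ts ! i))\<rbrakk>
   \<Longrightarrow> subtype \<Delta> (App \<gamma> ts) (App \<gamma> ts')"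
| Super: "\<lbrakk>t \<in> ground_types \<Delta>; inherits \<Delta> t t'; subtype \<Delta> t' t''\<rbrakk> \<Longrightarrow> subtype \<Delta> t t''"

text \<open>\<open>valid_var \<Delta> h \<tau>\<close> is the judgement \<open>h \<turnstile> \<tau>\<close>, where \<open>h\<close> is a list of parameters with variances.\<close>

function valid_var :: "'a class_table \<Rightarrow> (variance \<times> param) list \<Rightarrow> 'a trm \<Rightarrow> bool" where
  "valid_var \<Delta> h (Par x) \<longleftrightarrow> (\<exists>d \<in> {Invariant, Covariant}. (d, x) \<in> set h)"
| "valid_var \<Delta> h (App \<gamma> ts) \<longleftrightarrow> (\<forall>i < length ts.
     (var \<Delta> \<gamma> i \<in> {Invariant, Covariant} \<longrightarrow> valid_var \<Delta> h (ts ! i)) \<and>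
     (var \<Delta> \<gamma> i \<in> {Invariant, Contravariant} \<longrightarrow> valid_var \<Delta> (map (apfst neg_var) h) (ts ! i)))"
  by pat_completeness auto
termination
  by (relation "measure (\<lambda>(_, _, t). size t)")
    (auto simp: less_Suc_eq_le intro!: size_list_estimation' nth_mem)

definition acyclic_inheritance :: "'a class_table \<Rightarrow> bool" where
  "acyclic_inheritance \<Delta> \<longleftrightarrow>
     (\<forall>\<gamma> \<tau>s \<gamma>' \<tau>s'. (inherits \<Delta>)\<^sup>+\<^sup>+ (App \<gamma> \<tau>s) (App \<gamma>' \<tau>s') \<longrightarrow> \<gamma> \<noteq> \<gamma>')"

definition valid_variance :: "'a class_table \<Rightarrow> bool" where
  "valid_variance \<Delta> \<longleftrightarrow>
     (\<forall>\<gamma>\<in>classes \<Delta>. \<forall>\<tau>\<in>set (supers \<Delta> \<gamma>). valid_var \<Delta> (header \<Delta> \<gamma>) \<tau>)"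

definition well_formed :: "'a class_table \<Rightarrow> bool" where
  "well_formed \<Delta> \<longleftrightarrow> acyclic_inheritance \<Delta> \<and> valid_variance \<Delta>"

definition non_contravariant :: "'a class_table \<Rightarrow> bool" where
  "non_contravariant \<Delta> \<longleftrightarrow>
     (\<forall>\<gamma>\<in>classes \<Delta>. \<forall>i < crank \<Delta> \<gamma>. var \<Delta> \<gamma> i \<noteq> Contravariant)"

definition single_instantiation :: "'a class_table \<Rightarrow> bool" where
  "single_instantiation \<Delta> \<longleftrightarrow>
     (\<forall>\<gamma> \<gamma>' \<tau>s \<tau>s'. inh_plus \<Delta> \<gamma> (App \<gamma>' \<tau>s) \<longrightarrow> inh_plus \<Delta> \<gamma> (App \<gamma>' \<tau>s') \<longrightarrow> \<tau>s = \<tau>s')"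

definition conforms_TX :: "'a class_table \<Rightarrow> bool" where
  "conforms_TX \<Delta> \<longleftrightarrow>
     class_table \<Delta> \<and> well_formed \<Delta> \<and> non_contravariant \<Delta> \<and> single_instantiation \<Delta>"

definition table_forest :: "'a class_table \<Rightarrow> 'a trm \<Rightarrow> 'a set \<Rightarrow> 'a trm set" where
  "table_forest \<Delta> t_bot \<Sigma>_top = {t_top \<in> ground \<Sigma>_top (crank \<Delta>). subtype \<Delta> t_bot t_top}"

definition TX_forests :: "'a trm set set" where
  "TX_forests = {table_forest \<Delta> t_bot \<Sigma>_top | \<Delta> t_bot \<Sigma>_top.
     conforms_TX \<Delta> \<and> t_bot \<in> ground_types \<Delta> \<and> \<Sigma>_top \<subseteq> classes \<Delta>}"


section \<open>Deterministic context-free tree grammars\<close>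

text \<open>A production \<open>(v, xs, \<tau>)\<close> stands for \<open>v(xs) ::= \<tau>\<close>. As the two alphabets of a grammar are
  disjoint, a single rank function serves both.\<close>

record 'a tree_grammar =
  terminals :: "'a set"
  variables :: "'a set"
  grank :: "'a \<Rightarrow> nat"
  start :: 'a
  productions :: "('a \<times> param list \<times> 'a trm) set"

definition gnf_grammar :: "'a tree_grammar \<Rightarrow> bool" where
  "gnf_grammar G \<longleftrightarrow>
     finite (terminals G) \<and> finite (variables G) \<and> terminals G \<inter> variables G = {} \<and>
     start G \<in> variables G \<and> grank G (start G) = 0 \<and> finite (productions G) \<and>
     (\<forall>(v, xs, \<tau>) \<in> productions G.
        v \<in> variables G \<and> length xs = grank G v \<and> distinct xs \<and>
        (\<exists>\<sigma> \<tau>s. \<tau> = App \<sigma> \<tau>s \<and> \<sigma> \<in> terminals G \<and> length \<tau>s = grank G \<sigma> \<and>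
           set \<tau>s \<subseteq> terms (terminals G \<union> variables G) (grank G) (set xs)))"

text \<open>The first conjunct is the convention that a variable uses the same parameter names in all of
  its productions.\<close>

definition deterministic :: "'a tree_grammar \<Rightarrow> bool" where
  "deterministic G \<longleftrightarrow>
     (\<forall>v xs xs' \<tau> \<tau>'. (v, xs, \<tau>) \<in> productions G \<longrightarrow> (v, xs', \<tau>') \<in> productions G \<longrightarrow> xs = xs') \<and>
     (\<forall>v xs \<sigma> \<tau>s \<tau>s'. (v, xs, App \<sigma> \<tau>s) \<in> productions G \<longrightarrow>
        (v, xs, App \<sigma> \<tau>s') \<in> productions G \<longrightarrow> \<tau>s = \<tau>s')"

inductive derives :: "'a tree_grammar \<Rightarrow> 'a trm \<Rightarrow> 'a trm \<Rightarrow> bool" for G :: "'a tree_grammar" where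
  root: "\<lbrakk>App v ts \<in> ground (terminals G \<union> variables G) (grank G); (v, xs, \<tau>) \<in> productions G\<rbrakk>
    \<Longrightarrow> derives G (App v ts) (inst xs ts \<tau>)"
| ctxt: "\<lbrakk>App f (us @ t # ws) \<in> ground (terminals G \<union> variables G) (grank G); derives G t t'\<rbrakk>
    \<Longrightarrow> derives G (App f (us @ t # ws)) (App f (us @ t' # ws))"

definition grammar_forest :: "'a tree_grammar \<Rightarrow> 'a trm set" where
  "grammar_forest G =
     {t \<in> ground (terminals G) (grank G). (derives G)\<^sup>*\<^sup>* (App (start G) []) t}"

definition DCF :: "'a trm set set" where
  "DCF = {grammar_forest G | G. gnf_grammar G \<and> deterministic G}"

end

theory Submission imports Defs
begin

text \<open>Reading the productions of a deterministic grammar as inheritance declarations gives a table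
  whose parameters are all covariant. A subtype derivation is then an outermost derivation of the
  grammar, and transitivity of subtyping shows that arbitrary derivations yield no more terms.
  Conversely, single instantiation leaves at most one \<open>\<gamma>(x) :\<^sup>* \<gamma>'(\<tau>)\<close> for each pair of classes, so
  that \<open>\<gamma>\<close> becomes a variable with the productions \<open>\<gamma>(x) ::= \<gamma>'(\<tau>)\<close>. An argument in a covariant
  position may still be replaced by a supertype, one in an invariant position may not. Every type is
  therefore encoded twice, as a variable and as a terminal term, and every parameter has a copy for
  each encoding.\<close>

section \<open>Terms and substitution\<close>

lemma App_in_terms_iff [simp]:
  "App f ts \<in> terms A rk P \<longleftrightarrow> f \<in> A \<and> length ts = rk f \<and> (\<forall>t\<in>set ts. t \<in> terms A rk P)"
  by (subst terms.simps) auto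

lemma Par_in_terms_iff [simp]: "Par x \<in> terms A rk P \<longleftrightarrow> x \<in> P"
  by (subst terms.simps) auto

lemma terms_mono:
  assumes "t \<in> terms A rk P" "A \<subseteq> B" "P \<subseteq> Q"
  shows "t \<in> terms B rk Q"
  using assms by (induction t) auto

lemma terms_rank_cong:
  assumes "\<And>f. f \<in> A \<Longrightarrow> rk f = rk' f"
  shows "terms A rk P = terms A rk' P"
proof -
  have "t \<in> terms A rk P \<longleftrightarrow> t \<in> terms A rk' P" for t
    by (induction t) (use assms in auto)
  then show ?thesis by blast
qed

lemma subst_in_terms:
  assumes "t \<in> terms A rk P" "\<And>x. x \<in> P \<Longrightarrow> s x \<in> terms A rk Q"
  shows "subst s t \<in> terms A rk Q"
  using assms by (induction t) auto

lemma subst_Par [simp]: "subst Par t = t"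
  by (induction t) (auto simp: map_idI)

lemma inst_App [simp]: "inst xs ts (App f us) = App f (map (inst xs ts) us)"
  by (simp add: inst_def)

lemma inst_Nil [simp]: "inst [] ts t = t"
  by (simp add: inst_def)

text \<open>The position \<open>i\<close> is fixed before the list \<open>ts\<close> is given. Two
  substitutions for the same parameters can thus be compared position by position, as
  \<open>subtype_inst_mono\<close> does through \<open>inst_Par_index\<close>.\<close>

lemma map_of_zip_index:
  assumes "x \<in> set xs"
  shows "\<exists>i<length xs. \<forall>ts :: 'b list. length ts = length xs \<longrightarrow>
    map_of (zip xs ts) x = Some (ts ! i)"
  using assms
proof (induction xs)
  case (Cons y xs)
  show ?case
  proof (cases "x = y")
    case True
    then show ?thesis
      by (intro exI[of _ 0]) (auto simp: length_Suc_conv)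
  next
    case False
    with Cons obtain i where "i < length xs"
      "\<forall>ts :: 'b list. length ts = length xs \<longrightarrow> map_of (zip xs ts) x = Some (ts ! i)" by auto
    with False show ?thesis
      by (intro exI[of _ "Suc i"]) (auto simp: length_Suc_conv)
  qed
qed simp

lemma inst_Par_index:
  assumes "x \<in> set xs"
  shows "\<exists>i<length xs. \<forall>ts :: 'a trm list. length ts = length xs \<longrightarrow> inst xs ts (Par x) = ts ! i"
  using map_of_zip_index[OF assms, where 'b = "'a trm"] by (auto simp: inst_def)

lemma inst_in_terms:
  assumes "t \<in> terms A rk (set xs)" "length ts = length xs" "\<forall>t\<in>set ts. t \<in> terms A rk Q"
  shows "inst xs ts t \<in> terms A rk Q"
  unfolding inst_def
proof (rule subst_in_terms[OF assms(1)])
  fix x assume x: "x \<in> set xs"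
  obtain i where "i < length xs"
    "\<forall>ts :: 'a trm list. length ts = length xs \<longrightarrow> map_of (zip xs ts) x = Some (ts ! i)"
    using map_of_zip_index[OF x, where 'b = "'a trm"] by blast
  then show "(case map_of (zip xs ts) x of None \<Rightarrow> Par x | Some t \<Rightarrow> t) \<in> terms A rk Q"
    using assms(2,3) by (metis nth_mem option.simps(5))
qed

text \<open>All parameters of \<open>t\<close> lie in \<open>ys\<close>: one left over would be
  replaced through \<open>xs\<close> on the left-hand side but not on the right-hand side.\<close>

lemma inst_inst:
  assumes "t \<in> terms A rk (set ys)" "length us = length ys"
  shows "inst xs ts (inst ys us t) = inst ys (map (inst xs ts) us) t"
  using assms
proof (induction t)
  case (Par x)
  then have x: "x \<in> set ys" by simp
  then obtain i where "i < length ys"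
    "\<forall>ts :: 'a trm list. length ts = length ys \<longrightarrow> inst ys ts (Par x) = ts ! i"
    using inst_Par_index[OF x, where 'a = 'a] by blast
  then show ?case using Par.prems by simp
qed auto

lemma map_inst_Par:
  assumes "distinct xs" "length ts = length xs"
  shows "map (inst xs ts \<circ> Par) xs = ts"
proof (rule nth_equalityI)
  fix i assume "i < length (map (inst xs ts \<circ> Par) xs)"
  then show "map (inst xs ts \<circ> Par) xs ! i = ts ! i"
    using assms by (simp add: inst_def map_of_zip_nth)
qed (use assms in simp)

lemma inst_map_Par:
  fixes t :: "'a trm"
  shows "inst xs (map Par xs) t = t"
proof -
  have "(\<lambda>x. case map_of (zip xs (map Par xs)) x of None \<Rightarrow> Par x | Some t \<Rightarrow> t) = (Par :: param \<Rightarrow> 'a trm)"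
    by (auto simp: fun_eq_iff map_of_zip_map)
  then show ?thesis by (simp only: inst_def subst_Par)
qed


section \<open>Inheritance and subtyping\<close>

lemma crank_eq_length_params: "crank \<Delta> \<gamma> = length (params \<Delta> \<gamma>)"
  by (simp add: crank_def params_def)

lemma supers_in_terms:
  assumes "class_table \<Delta>" "\<gamma> \<in> classes \<Delta>" "\<tau> \<in> set (supers \<Delta> \<gamma>)"
  shows "\<tau> \<in> terms (classes \<Delta>) (crank \<Delta>) (set (params \<Delta> \<gamma>))"
  using assms by (auto simp: class_table_def)

lemma supers_cases:
  assumes "class_table \<Delta>" "\<gamma> \<in> classes \<Delta>" "\<tau> \<in> set (supers \<Delta> \<gamma>)"
  obtains \<gamma>' \<tau>s where "\<tau> = App \<gamma>' \<tau>s"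
  using assms by (cases \<tau>) (auto simp: class_table_def)

lemma distinct_params:
  assumes "class_table \<Delta>" "\<gamma> \<in> classes \<Delta>"
  shows "distinct (params \<Delta> \<gamma>)"
  using assms by (auto simp: class_table_def)

lemma inst_params_in_terms:
  assumes "\<tau> \<in> terms (classes \<Delta>) (crank \<Delta>) (set (params \<Delta> \<gamma>))"
    and "App \<gamma> ts \<in> terms (classes \<Delta>) (crank \<Delta>) P"
  shows "inst (params \<Delta> \<gamma>) ts \<tau> \<in> terms (classes \<Delta>) (crank \<Delta>) P"
  using inst_in_terms[OF assms(1)] assms(2) by (auto simp: crank_eq_length_params)

lemma inherits_in_terms:
  assumes "class_table \<Delta>" "inherits \<Delta> t t'" "t \<in> terms (classes \<Delta>) (crank \<Delta>) P"
  shows "t' \<in> terms (classes \<Delta>) (crank \<Delta>) P"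
  using assms(2)
proof cases
  case (1 \<gamma> ts \<tau>)
  then show ?thesis
    using assms inst_params_in_terms[OF supers_in_terms[OF assms(1)], of \<gamma> \<tau> ts P] by auto
qed

lemma subtype_ground:
  assumes "subtype \<Delta> t t'"
  shows "t \<in> ground_types \<Delta> \<and> t' \<in> ground_types \<Delta>"
  using assms by induction auto

lemma inh_star_in_terms:
  assumes "class_table \<Delta>" "inh_star \<Delta> \<gamma> \<tau>"
  shows "\<gamma> \<in> classes \<Delta> \<and> \<tau> \<in> terms (classes \<Delta>) (crank \<Delta>) (set (params \<Delta> \<gamma>))"
  using assms(2)
proof induction
  case (step \<gamma> \<gamma>' \<tau>s \<tau>)
  have "App \<gamma>' \<tau>s \<in> terms (classes \<Delta>) (crank \<Delta>) (set (params \<Delta> \<gamma>))"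
    using supers_in_terms[OF assms(1)] step by blast
  then show ?case using step inst_params_in_terms[of \<tau> \<Delta> \<gamma>'] by simp
qed (auto simp: crank_eq_length_params)

text \<open>By \<open>inst_inst\<close>, filling in \<open>ts\<close> commutes with the substitution
  that composes steps of \<open>inh_star\<close>. The arguments need not be ground, because
  \<open>inh_plus_inherits\<close> applies the lemma to declared supertypes that still contain
  parameters.\<close>

lemma inh_star_inherits:
  assumes "class_table \<Delta>" "inh_star \<Delta> \<gamma> \<tau>"
    and "App \<gamma> ts \<in> terms (classes \<Delta>) (crank \<Delta>) UNIV"
  shows "(inherits \<Delta>)\<^sup>*\<^sup>* (App \<gamma> ts) (inst (params \<Delta> \<gamma>) ts \<tau>)"
  using assms(2,3)
proof (induction arbitrary: ts)
  case (refl \<gamma>)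
  then show ?case
    using map_inst_Par[OF distinct_params[OF assms(1) refl(1)], of ts]
    by (simp add: crank_eq_length_params)
next
  case (step \<gamma> \<gamma>' \<tau>s \<tau>)
  let ?I = "inst (params \<Delta> \<gamma>) ts"
  have \<tau>s: "App \<gamma>' \<tau>s \<in> terms (classes \<Delta>) (crank \<Delta>) (set (params \<Delta> \<gamma>))"
    using supers_in_terms[OF assms(1)] step by blast
  have inh: "inherits \<Delta> (App \<gamma> ts) (App \<gamma>' (map ?I \<tau>s))"
    using inherits.intros[OF step.prems step.hyps(2)] by simp
  have "(inherits \<Delta>)\<^sup>*\<^sup>* (App \<gamma>' (map ?I \<tau>s)) (inst (params \<Delta> \<gamma>') (map ?I \<tau>s) \<tau>)"
    by (intro step.IH inherits_in_terms[OF assms(1) inh step.prems])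
  also have "inst (params \<Delta> \<gamma>') (map ?I \<tau>s) \<tau> = ?I (inst (params \<Delta> \<gamma>') \<tau>s \<tau>)"
    using inh_star_in_terms[OF assms(1) step.hyps(3)] \<tau>s
    by (intro inst_inst[symmetric]) (auto simp: crank_eq_length_params)
  finally show ?case using inh by (meson converse_rtranclp_into_rtranclp)
qed

text \<open>Carries inheritance between classes over to types, which is what
  \<open>acyclic_inheritance\<close> speaks of. The class is instantiated by its own parameters, a
  substitution that changes nothing.\<close>

lemma inh_plus_inherits:
  assumes "class_table \<Delta>" "inh_plus \<Delta> \<gamma> \<tau>"
  shows "(inherits \<Delta>)\<^sup>+\<^sup>+ (App \<gamma> (map Par (params \<Delta> \<gamma>))) \<tau>"
  using assms(2)
proof cases
  case (1 \<gamma>' \<tau>s \<tau>')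
  have "App \<gamma>' \<tau>s \<in> terms (classes \<Delta>) (crank \<Delta>) (set (params \<Delta> \<gamma>))"
    using supers_in_terms[OF assms(1)] 1 by blast
  then have "App \<gamma>' \<tau>s \<in> terms (classes \<Delta>) (crank \<Delta>) UNIV"
    using terms_mono[OF _ subset_refl subset_UNIV] by metis
  then have "(inherits \<Delta>)\<^sup>*\<^sup>* (App \<gamma>' \<tau>s) \<tau>"
    using inh_star_inherits[OF assms(1)] 1 by blast
  moreover have "inherits \<Delta> (App \<gamma> (map Par (params \<Delta> \<gamma>))) (App \<gamma>' \<tau>s)"
    using inherits.intros[of \<gamma> "map Par (params \<Delta> \<gamma>)" \<Delta> "App \<gamma>' \<tau>s"] 1
    by (simp only: inst_map_Par) (auto simp: crank_eq_length_params)
  ultimately show ?thesis by (rule rtranclp_into_tranclp2[rotated])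
qed

lemma inh_star_cases_plus:
  assumes "inh_star \<Delta> \<gamma> \<tau>"
  shows "\<tau> = App \<gamma> (map Par (params \<Delta> \<gamma>)) \<or> inh_plus \<Delta> \<gamma> \<tau>"
  using assms by cases (auto intro: inh_plus.intros)

text \<open>Single instantiation compares only instances reached in one or more steps. By acyclicity
  no such instance has the class \<open>\<gamma>\<close> itself as its head, so the zero-step
  instance has no competitor.\<close>

lemma inh_star_unique:
  assumes "class_table \<Delta>" "acyclic_inheritance \<Delta>" "single_instantiation \<Delta>"
    and "inh_star \<Delta> \<gamma> (App \<gamma>' \<tau>s)" "inh_star \<Delta> \<gamma> (App \<gamma>' \<tau>s')"
  shows "\<tau>s = \<tau>s'"
proof -
  have "\<gamma>' \<noteq> \<gamma>" if "inh_plus \<Delta> \<gamma> (App \<gamma>' us)" for us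
    using inh_plus_inherits[OF assms(1) that] assms(2) unfolding acyclic_inheritance_def by blast
  then show ?thesis
    using inh_star_cases_plus[OF assms(4)] inh_star_cases_plus[OF assms(5)] assms(3)
    unfolding single_instantiation_def by (metis trm.inject(2))
qed

lemma inherits_subtype_trans:
  assumes "class_table \<Delta>" "(inherits \<Delta>)\<^sup>*\<^sup>* t t'" "t \<in> ground_types \<Delta>" "subtype \<Delta> t' t''"
  shows "subtype \<Delta> t t''"
  using assms(2,3)
proof (induction rule: converse_rtranclp_induct)
  case base
  show ?case by fact
next
  case (step s s')
  then show ?case using inherits_in_terms[OF assms(1) step.hyps(1)] subtype.Super by metis
qed

text \<open>A subtype derivation is a chain of inheritance steps followed by one use of rule \<open>Var\<close>.\<close>

lemma subtype_iff_inh_star: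
  assumes "class_table \<Delta>" "non_contravariant \<Delta>"
    and "App \<gamma> ts \<in> ground_types \<Delta>" "App \<gamma>' ts' \<in> ground_types \<Delta>"
  shows "subtype \<Delta> (App \<gamma> ts) (App \<gamma>' ts') \<longleftrightarrow>
    (\<exists>\<tau>s. inh_star \<Delta> \<gamma> (App \<gamma>' \<tau>s) \<and> (\<forall>i < crank \<Delta> \<gamma>'.
       if var \<Delta> \<gamma>' i = Covariant then subtype \<Delta> (inst (params \<Delta> \<gamma>) ts (\<tau>s ! i)) (ts' ! i)
       else inst (params \<Delta> \<gamma>) ts (\<tau>s ! i) = ts' ! i))" (is "_ \<longleftrightarrow> (\<exists>\<tau>s. ?R \<gamma> ts \<tau>s)")
proof
  assume "subtype \<Delta> (App \<gamma> ts) (App \<gamma>' ts')"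
  then show "\<exists>\<tau>s. ?R \<gamma> ts \<tau>s"
  proof (induction "App \<gamma> ts" "App \<gamma>' ts'" arbitrary: \<gamma> ts)
    case (Var us)
    \<comment> \<open>No inheritance step was made, so the witness is the class applied to its own
      parameters; filling in \<open>us\<close> gives back the arguments.\<close>
    have arg: "inst (params \<Delta> \<gamma>') us (map Par (params \<Delta> \<gamma>') ! i) = us ! i"
      if "i < crank \<Delta> \<gamma>'" for i
    proof -
      have "map (inst (params \<Delta> \<gamma>') us \<circ> Par) (params \<Delta> \<gamma>') = us"
        using Var distinct_params[OF assms(1)]
        by (intro map_inst_Par) (auto simp: crank_eq_length_params)
      then have "map (inst (params \<Delta> \<gamma>') us \<circ> Par) (params \<Delta> \<gamma>') ! i = us ! i" by simp
      then show ?thesis using that by (simp add: crank_eq_length_params)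
    qed
    have "var \<Delta> \<gamma>' i = Invariant" if "i < crank \<Delta> \<gamma>'" "var \<Delta> \<gamma>' i \<noteq> Covariant" for i
      using that Var assms(2) by (cases "var \<Delta> \<gamma>' i") (auto simp: non_contravariant_def)
    then have "?R \<gamma>' us (map Par (params \<Delta> \<gamma>'))"
      using Var arg inh_star.refl[of \<gamma>' \<Delta>] by auto
    then show ?case by blast
  next
    case (Super t')
    from Super.hyps(2) obtain \<tau> where \<tau>: "\<tau> \<in> set (supers \<Delta> \<gamma>)" "t' = inst (params \<Delta> \<gamma>) ts \<tau>"
      by cases auto
    have \<gamma>: "\<gamma> \<in> classes \<Delta>" using Super.hyps(1) by simp
    obtain \<gamma>1 us where us: "\<tau> = App \<gamma>1 us"
      using supers_cases[OF assms(1) \<gamma> \<tau>(1)] .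
    have us': "App \<gamma>1 us \<in> terms (classes \<Delta>) (crank \<Delta>) (set (params \<Delta> \<gamma>))"
      using supers_in_terms[OF assms(1) \<gamma> \<tau>(1)] us by simp
    have t': "t' = App \<gamma>1 (map (inst (params \<Delta> \<gamma>) ts) us)"
      using \<tau> us by simp
    obtain \<tau>s where \<tau>s: "?R \<gamma>1 (map (inst (params \<Delta> \<gamma>) ts) us) \<tau>s"
      using Super.hyps(4)[OF t'] by blast
    have *: "App \<gamma>' \<tau>s \<in> terms (classes \<Delta>) (crank \<Delta>) (set (params \<Delta> \<gamma>1))"
      using inh_star_in_terms[OF assms(1)] \<tau>s by blast
    \<comment> \<open>The witness composes the declared supertype \<open>App \<gamma>1 us\<close>
      with the instance found for \<open>\<gamma>1\<close>. Filling in \<open>ts\<close> before or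
      after this composition makes no difference.\<close>
    have "inst (params \<Delta> \<gamma>) ts (inst (params \<Delta> \<gamma>1) us (\<tau>s ! i))
        = inst (params \<Delta> \<gamma>1) (map (inst (params \<Delta> \<gamma>) ts) us) (\<tau>s ! i)"
      if "i < crank \<Delta> \<gamma>'" for i
      using * that us' by (intro inst_inst) (auto simp: crank_eq_length_params)
    then have "?R \<gamma> ts (map (inst (params \<Delta> \<gamma>1) us) \<tau>s)"
      using \<tau>s * inh_star.step[OF \<gamma>, of \<gamma>1 us "App \<gamma>' \<tau>s"] \<tau> us by simp
    then show ?case by blast
  qed
next
  assume "\<exists>\<tau>s. ?R \<gamma> ts \<tau>s"
  then obtain \<tau>s where \<tau>s: "?R \<gamma> ts \<tau>s" by blast
  let ?I = "inst (params \<Delta> \<gamma>) ts"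
  have "App \<gamma>' \<tau>s \<in> terms (classes \<Delta>) (crank \<Delta>) (set (params \<Delta> \<gamma>))"
    using inh_star_in_terms[OF assms(1)] \<tau>s by blast
  then have "App \<gamma>' (map ?I \<tau>s) \<in> ground_types \<Delta>" "length \<tau>s = crank \<Delta> \<gamma>'"
    using inst_params_in_terms[of "App \<gamma>' \<tau>s"] assms(3) by (auto simp del: inst_App simp: inst_App[symmetric])
  then have "subtype \<Delta> (App \<gamma>' (map ?I \<tau>s)) (App \<gamma>' ts')"
    using \<tau>s assms(2,4) by (intro subtype.Var) (auto simp: non_contravariant_def split: if_splits)
  moreover have "(inherits \<Delta>)\<^sup>*\<^sup>* (App \<gamma> ts) (App \<gamma>' (map ?I \<tau>s))"
    using inh_star_inherits[OF assms(1), of \<gamma> "App \<gamma>' \<tau>s" ts] \<tau>s assms(3)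
      terms_mono[OF assms(3) subset_refl, of UNIV] by simp
  ultimately show "subtype \<Delta> (App \<gamma> ts) (App \<gamma>' ts')"
    using inherits_subtype_trans[OF assms(1)] assms(3) by blast
qed

section \<open>Subtyping in tables with covariant parameters only\<close>

definition all_covariant :: "'a class_table \<Rightarrow> bool" where
  "all_covariant \<Delta> \<longleftrightarrow> (\<forall>\<gamma>\<in>classes \<Delta>. \<forall>i < crank \<Delta> \<gamma>. var \<Delta> \<gamma> i = Covariant)"

lemma subtype_App_covariant:
  assumes "all_covariant \<Delta>" "App \<gamma> ts \<in> ground_types \<Delta>" "App \<gamma> ts' \<in> ground_types \<Delta>"
    and "\<And>i. i < crank \<Delta> \<gamma> \<Longrightarrow> subtype \<Delta> (ts ! i) (ts' ! i)"
  shows "subtype \<Delta> (App \<gamma> ts) (App \<gamma> ts')"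
  using assms by (intro subtype.Var) (auto simp: all_covariant_def)

lemma subtype_refl_covariant:
  assumes "all_covariant \<Delta>" "t \<in> ground_types \<Delta>"
  shows "subtype \<Delta> t t"
  using assms(2) by (induction t) (auto intro!: subtype_App_covariant[OF assms(1)])

text \<open>Every occurrence of a parameter in \<open>\<tau>\<close> is in a covariant position, so
  rule \<open>Var\<close> carries the comparison of the arguments up to the root.\<close>

lemma subtype_inst_mono:
  assumes "all_covariant \<Delta>" "\<tau> \<in> terms (classes \<Delta>) (crank \<Delta>) (set xs)"
    and "length ts = length xs" "length ts' = length xs"
    and "\<And>i. i < length xs \<Longrightarrow> subtype \<Delta> (ts ! i) (ts' ! i)"
  shows "subtype \<Delta> (inst xs ts \<tau>) (inst xs ts' \<tau>)"
  using assms(2)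
proof (induction \<tau> rule: trm.induct)
  case (Par x)
  then obtain i where "i < length xs"
    "\<forall>ts :: 'a trm list. length ts = length xs \<longrightarrow> inst xs ts (Par x) = ts ! i"
    using inst_Par_index[of x xs, where 'a = 'a] by auto
  then show ?case using assms by simp
next
  case (App f us)
  have "\<forall>t\<in>set ts. t \<in> ground_types \<Delta>" "\<forall>t\<in>set ts'. t \<in> ground_types \<Delta>"
    using assms(3-5) subtype_ground by (metis in_set_conv_nth)+
  then have "inst xs ts (App f us) \<in> ground_types \<Delta>" "inst xs ts' (App f us) \<in> ground_types \<Delta>"
    using inst_in_terms[OF App.prems] assms(3,4) by metis+
  then show ?case
    using App by (auto intro!: subtype_App_covariant[OF assms(1)])
qed

text \<open>Induction on the right derivation with an inner induction on the left one.
  \<open>Super\<close> on the left stays in front. The essential case is \<open>Var\<close> on the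
  left followed by \<open>Super\<close> on the right: the two are swapped, the inheritance step is
  made from the smaller type, and its result is compared by
  \<open>subtype_inst_mono\<close>.\<close>

lemma subtype_trans_covariant:
  assumes "class_table \<Delta>" "all_covariant \<Delta>" "subtype \<Delta> t t'" "subtype \<Delta> t' t''"
  shows "subtype \<Delta> t t''"
  using assms(4,3)
proof (induction arbitrary: t)
  case (Var \<gamma> ts' ts'')
  note outer = Var.hyps
  show ?case
    using Var.prems Var.IH
  proof (induction t "App \<gamma> ts'")
    case (Var ts)
    then show ?case
      using outer assms(2)
      by (intro subtype_App_covariant[OF assms(2)]) (auto simp: all_covariant_def)
  next
    case (Super t t')
    then show ?case using subtype.Super by blast
  qed
next
  case (Super t' s t'')
  from Super.hyps(2) obtain \<gamma> ts' \<tau> where t': "t' = App \<gamma> ts'" "\<gamma> \<in> classes \<Delta>"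
    "\<tau> \<in> set (supers \<Delta> \<gamma>)" "s = inst (params \<Delta> \<gamma>) ts' \<tau>"
    by cases auto
  show ?case
    using Super.prems Super.hyps Super.IH t'
  proof (induction t t')
    case (Var \<gamma>1 ts ts1)
    then have eq: "\<gamma>1 = \<gamma>" "ts1 = ts'" by auto
    have "subtype \<Delta> (inst (params \<Delta> \<gamma>) ts \<tau>) (inst (params \<Delta> \<gamma>) ts' \<tau>)"
      using Var eq supers_in_terms[OF assms(1)] assms(2)
      by (intro subtype_inst_mono) (auto simp: crank_eq_length_params all_covariant_def)
    then have "subtype \<Delta> (inst (params \<Delta> \<gamma>) ts \<tau>) t''"
      using Var.prems t' by blast
    moreover have "inherits \<Delta> (App \<gamma> ts) (inst (params \<Delta> \<gamma>) ts \<tau>)"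
      using t' Var.hyps(1) eq terms_mono[OF Var.hyps(1) subset_refl, of UNIV]
      by (intro inherits.intros) auto
    ultimately show ?case using subtype.Super Var.hyps(1) eq by blast
  next
    case (Super t u t')
    then show ?case using subtype.Super by blast
  qed
qed


section \<open>The class table of a deterministic grammar\<close>

text \<open>For a variable with productions these are the names that determinism makes common to all
  of them. Any other symbol gets default names, as many as its rank demands.\<close>

definition grammar_params :: "'a tree_grammar \<Rightarrow> 'a \<Rightarrow> param list" where
  "grammar_params G v = (if \<exists>xs \<tau>. (v, xs, \<tau>) \<in> productions G
     then SOME xs. \<exists>\<tau>. (v, xs, \<tau>) \<in> productions G else [0..<grank G v])"

text \<open>Terminals become classes without supertypes. The productions of a variable are listed in
  an arbitrary order, since inheritance depends only on the set of declared supertypes.\<close>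

definition grammar_table :: "'a tree_grammar \<Rightarrow> 'a class_table" where
  "grammar_table G = \<lparr>classes = terminals G \<union> variables G,
     header = \<lambda>v. map (Pair Covariant) (grammar_params G v),
     supers = \<lambda>v. SOME \<tau>s. set \<tau>s = {\<tau>. (v, grammar_params G v, \<tau>) \<in> productions G}\<rparr>"

lemma derives_rtranclp_ctxt:
  assumes "(derives G)\<^sup>*\<^sup>* t t'"
    and "\<And>t. App f (us @ t # ws) \<in> ground (terminals G \<union> variables G) (grank G) \<longleftrightarrow>
      t \<in> ground (terminals G \<union> variables G) (grank G)"
    and "\<And>s s'. derives G s s' \<Longrightarrow> s \<in> ground (terminals G \<union> variables G) (grank G)"
  shows "(derives G)\<^sup>*\<^sup>* (App f (us @ t # ws)) (App f (us @ t' # ws))"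
  using assms(1)
proof induction
  case (step s s')
  then show ?case
    using derives.ctxt[of f us s ws G s'] assms(2,3) by (meson rtranclp.rtrancl_into_rtrancl)
qed simp

locale deterministic_grammar =
  fixes G :: "'a tree_grammar"
  assumes gnf: "gnf_grammar G" and det: "deterministic G"
begin

abbreviation T :: "'a class_table" where
  "T \<equiv> grammar_table G"

lemma classes_T [simp]: "classes T = terminals G \<union> variables G"
  by (simp add: grammar_table_def)

lemma params_T [simp]: "params T v = grammar_params G v"
  by (simp add: grammar_table_def params_def comp_def)

lemma productionD:
  assumes "(v, xs, \<tau>) \<in> productions G"
  shows "v \<in> variables G" "length xs = grank G v" "distinct xs"
    and "\<exists>\<sigma> \<tau>s. \<tau> = App \<sigma> \<tau>s \<and> \<sigma> \<in> terminals G"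
    and "\<tau> \<in> terms (terminals G \<union> variables G) (grank G) (set xs)"
proof -
  have *: "v \<in> variables G \<and> length xs = grank G v \<and> distinct xs \<and>
    (\<exists>\<sigma> \<tau>s. \<tau> = App \<sigma> \<tau>s \<and> \<sigma> \<in> terminals G \<and> length \<tau>s = grank G \<sigma> \<and>
       set \<tau>s \<subseteq> terms (terminals G \<union> variables G) (grank G) (set xs))"
    using gnf assms unfolding gnf_grammar_def by fast
  then show "v \<in> variables G" "length xs = grank G v" "distinct xs"
    "\<exists>\<sigma> \<tau>s. \<tau> = App \<sigma> \<tau>s \<and> \<sigma> \<in> terminals G" by blast+
  from * show "\<tau> \<in> terms (terminals G \<union> variables G) (grank G) (set xs)" by auto
qed

lemma production_params:
  assumes "(v, xs, \<tau>) \<in> productions G"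
  shows "xs = grammar_params G v"
proof -
  have "\<exists>\<tau>. (v, SOME xs. \<exists>\<tau>. (v, xs, \<tau>) \<in> productions G, \<tau>) \<in> productions G"
    by (rule someI_ex) (use assms in blast)
  then have "\<exists>\<tau>. (v, grammar_params G v, \<tau>) \<in> productions G"
    using assms by (auto simp: grammar_params_def)
  then show ?thesis
    using assms det unfolding deterministic_def by blast
qed

lemma grammar_params_simps [simp]:
  "length (grammar_params G v) = grank G v" "distinct (grammar_params G v)"
proof -
  have "length (grammar_params G v) = grank G v \<and> distinct (grammar_params G v)"
  proof (cases "\<exists>xs \<tau>. (v, xs, \<tau>) \<in> productions G")
    case True
    then show ?thesis using production_params productionD by blast
  next
    case False
    then show ?thesis unfolding grammar_params_def by simp
  qed
  then show "length (grammar_params G v) = grank G v" "distinct (grammar_params G v)" by auto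
qed

lemma crank_T [simp]: "crank T = grank G"
  by (simp add: fun_eq_iff crank_eq_length_params)

lemma set_supers_T [simp]: "set (supers T v) = {\<tau>. (v, grammar_params G v, \<tau>) \<in> productions G}"
proof -
  have "finite (productions G)" using gnf by (simp add: gnf_grammar_def)
  then have "finite ((\<lambda>(_, _, \<tau>). \<tau>) ` productions G)" by simp
  moreover have "{\<tau>. (v, grammar_params G v, \<tau>) \<in> productions G} \<subseteq> (\<lambda>(_, _, \<tau>). \<tau>) ` productions G"
    by force
  ultimately have "\<exists>\<tau>s. set \<tau>s = {\<tau>. (v, grammar_params G v, \<tau>) \<in> productions G}"
    by (intro finite_list) (rule finite_subset)
  then show ?thesis
    unfolding grammar_table_def class_table.simps by (rule someI_ex)
qed

lemma terminal_no_production: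
  assumes "\<sigma> \<in> terminals G"
  shows "(\<sigma>, xs, \<tau>) \<notin> productions G"
  using assms gnf productionD(1) by (auto simp: gnf_grammar_def)

section \<open>Conformance of the table to the type system\<close>

lemma class_table_T: "class_table T"
proof -
  have "finite (classes T)" using gnf by (simp add: gnf_grammar_def)
  then show ?thesis
    using productionD(4,5) unfolding class_table_def by fastforce
qed

lemma all_covariant_T: "all_covariant T"
proof -
  have "var T v i = Covariant" if "i < grank G v" for v i
    using that by (simp add: var_def grammar_table_def)
  then show ?thesis by (simp add: all_covariant_def)
qed

lemma inherits_T_cases:
  assumes "inherits T t t'"
  obtains v ts \<sigma> \<tau>s where "t = App v ts" "v \<in> variables G" "\<sigma> \<in> terminals G"
    "(v, grammar_params G v, App \<sigma> \<tau>s) \<in> productions G"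
    "t' = App \<sigma> (map (inst (grammar_params G v) ts) \<tau>s)"
  using assms
proof cases
  case (1 v ts \<tau>)
  then have "(v, grammar_params G v, \<tau>) \<in> productions G" by simp
  moreover from this obtain \<sigma> \<tau>s where "\<tau> = App \<sigma> \<tau>s" "\<sigma> \<in> terminals G"
    using productionD(4) by blast
  ultimately show ?thesis using that 1 productionD(1) by simp
qed

text \<open>In Greibach normal form a right-hand side has a terminal at its root, and terminals have
  no productions. Inheritance therefore stops after one step.\<close>

lemma inh_plus_T_supers:
  assumes "inh_plus T v \<tau>"
  shows "\<tau> \<in> set (supers T v)"
  using assms
proof cases
  case (1 \<sigma> \<tau>s \<tau>')
  then have prod: "(v, grammar_params G v, App \<sigma> \<tau>s) \<in> productions G" by simp
  then have \<sigma>: "\<sigma> \<in> terminals G" and len: "length \<tau>s = grank G \<sigma>"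
    using productionD(4,5)[OF prod] by auto
  from \<open>inh_star T \<sigma> \<tau>'\<close> have "\<tau>' = App \<sigma> (map Par (grammar_params G \<sigma>))"
    by cases (use \<sigma> terminal_no_production in auto)
  then show ?thesis using 1 len prod by (simp add: map_inst_Par)
qed

lemma conforms_T: "conforms_TX T"
proof -
  have "acyclic_inheritance T"
    unfolding acyclic_inheritance_def
  proof (intro allI impI)
    fix v ts v' ts'
    assume *: "(inherits T)\<^sup>+\<^sup>+ (App v ts) (App v' ts')"
    \<comment> \<open>The first step leaves a variable and the last one enters a terminal; the two
      alphabets are disjoint.\<close>
    obtain s where "inherits T (App v ts) s" using tranclpD[OF *] by blast
    then have v: "v \<in> variables G" by (rule inherits_T_cases) simp
    obtain s' where "inherits T s' (App v' ts')" using * by (cases rule: tranclp.cases)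
    then have "v' \<in> terminals G" by (rule inherits_T_cases) simp
    with v show "v \<noteq> v'" using gnf by (auto simp: gnf_grammar_def)
  qed
  moreover have "valid_var T (header T v) \<tau>"
    if "\<tau> \<in> terms (classes T) (crank T) (set (params T v))" for v \<tau>
    using that
  proof (induction \<tau> rule: trm.induct)
    case (Par x)
    then show ?case by (auto simp: grammar_table_def params_def)
  next
    case (App f ts)
    then have "var T f i = Covariant" if "i < length ts" for i
      using all_covariant_T that by (simp add: all_covariant_def)
    with App show ?case by simp
  qed
  then have "valid_variance T"
    unfolding valid_variance_def using supers_in_terms[OF class_table_T] by blast
  moreover have "single_instantiation T"
    unfolding single_instantiation_def
  proof (intro allI impI)
    fix v \<sigma> \<tau>s \<tau>s'
    assume "inh_plus T v (App \<sigma> \<tau>s)" "inh_plus T v (App \<sigma> \<tau>s')"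
    then have "(v, grammar_params G v, App \<sigma> \<tau>s) \<in> productions G"
      "(v, grammar_params G v, App \<sigma> \<tau>s') \<in> productions G"
      using inh_plus_T_supers by force+
    then show "\<tau>s = \<tau>s'" using det unfolding deterministic_def by blast
  qed
  moreover have "non_contravariant T"
    using all_covariant_T by (auto simp: non_contravariant_def all_covariant_def)
  ultimately show ?thesis
    using class_table_T by (simp add: conforms_TX_def well_formed_def)
qed

section \<open>Derivations as subtyping\<close>

lemma derives_subtype:
  assumes "derives G t t'"
  shows "subtype T t t'"
  using assms
proof induction
  case (root v ts xs \<tau>)
  have gr: "App v ts \<in> ground_types T" using root(1) by simp
  have "App v ts \<in> terms (classes T) (crank T) UNIV"
    by (rule terms_mono[OF gr subset_refl]) simp
  moreover have "\<tau> \<in> set (supers T v)"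
    using root(2) production_params[OF root(2)] by simp
  ultimately have "inherits T (App v ts) (inst (params T v) ts \<tau>)"
    by (rule inherits.intros)
  then have inh: "inherits T (App v ts) (inst xs ts \<tau>)"
    by (simp only: params_T flip: production_params[OF root(2)])
  have "inst xs ts \<tau> \<in> ground_types T"
    by (rule inherits_in_terms[OF class_table_T inh gr])
  then show ?case
    by (intro subtype.Super[OF gr inh] subtype_refl_covariant[OF all_covariant_T])
next
  case (ctxt f us t ws t')
  have t: "App f (us @ t # ws) \<in> ground_types T" using ctxt.hyps(1) by simp
  then have t': "App f (us @ t' # ws) \<in> ground_types T"
    using subtype_ground[OF ctxt.IH] by simp
  \<comment> \<open>Only the argument at position \<open>length us\<close> is rewritten; the others
    are related by reflexivity. As all positions are covariant, \<open>Var\<close> then applies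
    whatever the context is.\<close>
  have "subtype T ((us @ t # ws) ! i) ((us @ t' # ws) ! i)" if "i < crank T f" for i
  proof (cases "i = length us")
    case False
    then have eq: "(us @ t # ws) ! i = (us @ t' # ws) ! i"
      by (simp add: nth_append nth_Cons')
    have "i < length (us @ t # ws)" using t that by simp
    then have "(us @ t # ws) ! i \<in> set (us @ t # ws)" by (rule nth_mem)
    then have "(us @ t # ws) ! i \<in> ground_types T"
      using t unfolding App_in_terms_iff by blast
    then show ?thesis unfolding eq[symmetric] by (rule subtype_refl_covariant[OF all_covariant_T])
  qed (use ctxt.IH in simp)
  then show ?case by (rule subtype_App_covariant[OF all_covariant_T t t'])
qed

lemma derives_rtranclp_App:
  assumes "App f ts \<in> ground_types T" "App f ts' \<in> ground_types T"
    and "\<And>i. i < grank G f \<Longrightarrow> (derives G)\<^sup>*\<^sup>* (ts ! i) (ts' ! i)"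
  shows "(derives G)\<^sup>*\<^sup>* (App f ts) (App f ts')"
proof -
  have len: "length ts = grank G f" "length ts' = grank G f"
    and gr: "\<forall>t\<in>set ts. t \<in> ground_types T" "\<forall>t\<in>set ts'. t \<in> ground_types T" "f \<in> classes T"
    using assms(1,2) by auto
  \<comment> \<open>The arguments are rewritten from left to right: after \<open>k\<close> rounds
    the first \<open>k\<close> of them are already those of \<open>ts'\<close>.\<close>
  have "(derives G)\<^sup>*\<^sup>* (App f ts) (App f (take k ts' @ drop k ts))" if "k \<le> grank G f" for k
    using that
  proof (induction k)
    case (Suc k)
    then have k: "k < length ts" "k < length ts'" using len by auto
    have "(derives G)\<^sup>*\<^sup>* (App f (take k ts' @ ts ! k # drop (Suc k) ts))
        (App f (take k ts' @ ts' ! k # drop (Suc k) ts))"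
    proof (rule derives_rtranclp_ctxt)
      show "(derives G)\<^sup>*\<^sup>* (ts ! k) (ts' ! k)" using assms(3) k len by simp
      show "App f (take k ts' @ t # drop (Suc k) ts) \<in> ground (terminals G \<union> variables G) (grank G) \<longleftrightarrow>
          t \<in> ground (terminals G \<union> variables G) (grank G)" for t
        using gr k len by (auto dest: in_set_takeD in_set_dropD)
      show "derives G s s' \<Longrightarrow> s \<in> ground (terminals G \<union> variables G) (grank G)" for s s'
        using derives_subtype subtype_ground by (metis classes_T crank_T)
    qed
    then show ?case
      using Suc k by (simp add: Cons_nth_drop_Suc take_Suc_conv_app_nth)
  qed simp
  from this[of "grank G f"] show ?thesis using len by simp
qed

lemma subtype_T_iff_derives:
  assumes "t \<in> ground (terminals G \<union> variables G) (grank G)"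
  shows "subtype T t t' \<longleftrightarrow> (derives G)\<^sup>*\<^sup>* t t'"
proof
  assume "(derives G)\<^sup>*\<^sup>* t t'"
  then show "subtype T t t'"
    using assms
  proof (induction)
    case base
    then show ?case using subtype_refl_covariant[OF all_covariant_T] by simp
  next
    case (step s s')
    then show ?case
      using derives_subtype subtype_trans_covariant[OF class_table_T all_covariant_T] by blast
  qed
next
  assume "subtype T t t'"
  then show "(derives G)\<^sup>*\<^sup>* t t'"
  proof induction
    case (Var f ts ts')
    then show ?case
      using all_covariant_T by (intro derives_rtranclp_App) (auto simp: all_covariant_def)
  next
    case (Super t s t'')
    from \<open>inherits T t s\<close> have "derives G t s"
    proof (cases rule: inherits_T_cases)
      case (1 v ts \<sigma> \<tau>s)
      then show ?thesis
        using derives.root[of v ts G "grammar_params G v" "App \<sigma> \<tau>s"] Super.hyps(1) by simp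
    qed
    then show ?case using Super by (meson converse_rtranclp_into_rtranclp)
  qed
qed

lemma grammar_forest_eq: "grammar_forest G = table_forest T (App (start G) []) (terminals G)"
  using gnf subtype_T_iff_derives[of "App (start G) []"]
  by (auto simp: gnf_grammar_def grammar_forest_def table_forest_def)

lemma grammar_forest_in_TX: "grammar_forest G \<in> TX_forests"
  unfolding TX_forests_def grammar_forest_eq
  using conforms_T gnf by (intro CollectI exI conjI refl) (auto simp: gnf_grammar_def)

text \<open>Derivations may rewrite subterms in any order, whereas a subtype derivation is read off
  from its last rule. The passage through the table thus replaces a reordering argument. As a
  terminal has no supertypes, only \<open>Var\<close> is possible.\<close>

lemma derives_terminal_iff:
  assumes "\<sigma> \<in> terminals G"
    and "App \<sigma> ts \<in> ground (terminals G \<union> variables G) (grank G)"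
    and "App \<sigma>' ts' \<in> ground (terminals G \<union> variables G) (grank G)"
  shows "(derives G)\<^sup>*\<^sup>* (App \<sigma> ts) (App \<sigma>' ts') \<longleftrightarrow>
    \<sigma> = \<sigma>' \<and> (\<forall>i < grank G \<sigma>. (derives G)\<^sup>*\<^sup>* (ts ! i) (ts' ! i))"
proof
  assume "(derives G)\<^sup>*\<^sup>* (App \<sigma> ts) (App \<sigma>' ts')"
  then have "subtype T (App \<sigma> ts) (App \<sigma>' ts')"
    using subtype_T_iff_derives assms(2) by blast
  then show "\<sigma> = \<sigma>' \<and> (\<forall>i < grank G \<sigma>. (derives G)\<^sup>*\<^sup>* (ts ! i) (ts' ! i))"
  proof cases
    case Var
    then have "subtype T (ts ! i) (ts' ! i)" if "i < grank G \<sigma>" for i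
      using that all_covariant_T by (simp add: all_covariant_def)
    then show ?thesis
      using subtype_T_iff_derives subtype_ground Var(1) by (metis classes_T crank_T)
  next
    case (Super t')
    from \<open>inherits T (App \<sigma> ts) t'\<close> show ?thesis
      by (rule inherits_T_cases) (use assms(1) terminal_no_production in auto)
  qed
next
  assume "\<sigma> = \<sigma>' \<and> (\<forall>i < grank G \<sigma>. (derives G)\<^sup>*\<^sup>* (ts ! i) (ts' ! i))"
  then show "(derives G)\<^sup>*\<^sup>* (App \<sigma> ts) (App \<sigma>' ts')"
    using assms(2,3) by (auto intro!: derives_rtranclp_App)
qed

text \<open>Rule \<open>Var\<close> would keep the variable at the root, so the subtype derivation
  starts with a production. That production already puts a terminal there, and by
  \<open>derives_terminal_iff\<close> the rest happens inside the arguments.\<close>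

lemma derives_variable_iff:
  assumes "v \<in> variables G" "\<sigma> \<in> terminals G"
    and "App v ts \<in> ground (terminals G \<union> variables G) (grank G)"
    and "App \<sigma> ts' \<in> ground (terminals G \<union> variables G) (grank G)"
  shows "(derives G)\<^sup>*\<^sup>* (App v ts) (App \<sigma> ts') \<longleftrightarrow>
    (\<exists>xs \<tau>s. (v, xs, App \<sigma> \<tau>s) \<in> productions G \<and>
       (\<forall>i < grank G \<sigma>. (derives G)\<^sup>*\<^sup>* (inst xs ts (\<tau>s ! i)) (ts' ! i)))"
proof -
  have iff: "(derives G)\<^sup>*\<^sup>* (App \<rho> (map (inst xs ts) \<tau>s)) (App \<sigma> ts') \<longleftrightarrow> \<rho> = \<sigma> \<and>
      (\<forall>i < grank G \<sigma>. (derives G)\<^sup>*\<^sup>* (inst xs ts (\<tau>s ! i)) (ts' ! i))"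
    if prod: "(v, xs, App \<rho> \<tau>s) \<in> productions G" for xs \<rho> \<tau>s
  proof -
    note p = productionD[OF prod]
    have "inst xs ts (App \<rho> \<tau>s) \<in> ground (terminals G \<union> variables G) (grank G)"
      using p(2,5) assms(3) by (intro inst_in_terms) auto
    then show ?thesis
      using p(4,5) assms(4) by (subst derives_terminal_iff) auto
  qed
  show ?thesis
  proof
    assume "(derives G)\<^sup>*\<^sup>* (App v ts) (App \<sigma> ts')"
    then have "subtype T (App v ts) (App \<sigma> ts')"
      using subtype_T_iff_derives assms(3) by blast
    then obtain s where s: "inherits T (App v ts) s" "subtype T s (App \<sigma> ts')"
      using assms(1,2) gnf by cases (auto simp: gnf_grammar_def)
    from s(2) have *: "(derives G)\<^sup>*\<^sup>* s (App \<sigma> ts')"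
      using subtype_T_iff_derives subtype_ground by (metis classes_T crank_T)
    from s(1) show "\<exists>xs \<tau>s. (v, xs, App \<sigma> \<tau>s) \<in> productions G \<and>
       (\<forall>i < grank G \<sigma>. (derives G)\<^sup>*\<^sup>* (inst xs ts (\<tau>s ! i)) (ts' ! i))"
      by (cases rule: inherits_T_cases) (use * iff in auto)
  next
    assume "\<exists>xs \<tau>s. (v, xs, App \<sigma> \<tau>s) \<in> productions G \<and>
       (\<forall>i < grank G \<sigma>. (derives G)\<^sup>*\<^sup>* (inst xs ts (\<tau>s ! i)) (ts' ! i))"
    then obtain xs \<tau>s where prod: "(v, xs, App \<sigma> \<tau>s) \<in> productions G"
      and "\<forall>i < grank G \<sigma>. (derives G)\<^sup>*\<^sup>* (inst xs ts (\<tau>s ! i)) (ts' ! i)" by blast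
    then have "(derives G)\<^sup>*\<^sup>* (inst xs ts (App \<sigma> \<tau>s)) (App \<sigma> ts')"
      using iff by simp
    then show "(derives G)\<^sup>*\<^sup>* (App v ts) (App \<sigma> ts')"
      using derives.root[OF assms(3) prod] by (meson converse_rtranclp_into_rtranclp)
  qed
qed

end

section \<open>The grammar of a class table\<close>

lemma map_of_zip_map_inj:
  assumes "inj f"
  shows "map_of (zip (map f xs) (map g ts)) (f x) = map_option g (map_of (zip xs ts) x)"
proof (induction xs ts rule: list_induct2')
  case (4 y xs t ts)
  then show ?case using assms by (simp add: inj_eq)
qed simp_all

text \<open>A parameter \<open>x\<close> is split into \<open>2 * x\<close>, which receives the argument as a variable deriving all
  its supertypes, and \<open>2 * x + 1\<close>, which receives the argument as a term deriving only itself.\<close>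

definition split_params :: "param list \<Rightarrow> param list" where
  "split_params xs = map (\<lambda>x. 2 * x) xs @ map (\<lambda>x. 2 * x + 1) xs"

text \<open>Even and odd names never meet, so a lookup in one half of the list cannot hit the other
  half.\<close>

lemma map_of_split_params:
  assumes "length ts = length xs"
  shows "map_of (zip (split_params xs) (map f ts @ map g ts)) (2 * x) = map_option f (map_of (zip xs ts) x)"
    and "map_of (zip (split_params xs) (map f ts @ map g ts)) (2 * x + 1) = map_option g (map_of (zip xs ts) x)"
proof -
  have inj: "inj (\<lambda>x::nat. 2 * x)" "inj (\<lambda>x::nat. 2 * x + 1)"
    by (auto intro: injI)
  have even: "map_of (zip (map (\<lambda>x. 2 * x + 1) xs) (map g ts)) (2 * x) = None"
    using assms by (auto simp: map_of_eq_None_iff dest!: set_zip_leftD) presburger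
  have odd: "map_of (zip (map (\<lambda>x. 2 * x) xs) (map f ts)) (2 * x + 1) = None"
    using assms by (auto simp: map_of_eq_None_iff dest!: set_zip_leftD) presburger
  have zip: "zip (split_params xs) (map f ts @ map g ts) =
      zip (map (\<lambda>x. 2 * x) xs) (map f ts) @ zip (map (\<lambda>x. 2 * x + 1) xs) (map g ts)"
    using assms by (simp add: split_params_def)
  show "map_of (zip (split_params xs) (map f ts @ map g ts)) (2 * x) = map_option f (map_of (zip xs ts) x)"
    unfolding zip map_of_append map_add_def even map_of_zip_map_inj[OF inj(1)]
    by (simp split: option.split)
  show "map_of (zip (split_params xs) (map f ts @ map g ts)) (2 * x + 1) = map_option g (map_of (zip xs ts) x)"
    unfolding zip map_of_append map_add_def odd map_of_zip_map_inj[OF inj(2)]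
    by (simp split: option.split)
qed

text \<open>A class may play two roles in the grammar: it is itself a terminal if it lies in
  \<open>\<Sigma>\<close>, and \<open>hat\<close> gives the variable standing for it. All new
  symbols come from the type of the classes, hence the freshness assumptions.\<close>

locale table_to_grammar =
  fixes \<Delta> :: "'a class_table" and \<gamma>\<^sub>0 :: 'a and ts\<^sub>0 :: "'a trm list" and \<Sigma> :: "'a set"
    and hat :: "'a \<Rightarrow> 'a" and v\<^sub>0 dead :: 'a
  assumes conforms: "conforms_TX \<Delta>"
    and bottom: "App \<gamma>\<^sub>0 ts\<^sub>0 \<in> ground_types \<Delta>"
    and tops: "\<Sigma> \<subseteq> classes \<Delta>"
    and inj_hat: "inj_on hat (classes \<Delta>)"
    and hat_fresh: "hat ` classes \<Delta> \<inter> classes \<Delta> = {}"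
    and v\<^sub>0_fresh: "v\<^sub>0 \<notin> classes \<Delta> \<union> hat ` classes \<Delta>"
    and dead_fresh: "dead \<notin> insert v\<^sub>0 (classes \<Delta> \<union> hat ` classes \<Delta>)"
begin

lemma conformsD:
  "class_table \<Delta>" "acyclic_inheritance \<Delta>" "non_contravariant \<Delta>" "single_instantiation \<Delta>"
  using conforms by (auto simp: conforms_TX_def well_formed_def)

text \<open>The variable \<open>dead\<close> has no productions, so that an invariant argument with a class outside \<open>\<Sigma>\<close>
  derives nothing.\<close>

primrec exact :: "'a trm \<Rightarrow> 'a trm" where
  "exact (Par x) = Par (2 * x + 1)"
| "exact (App \<gamma> ts) = (if \<gamma> \<in> \<Sigma> then App \<gamma> (map exact ts) else App dead [])"

text \<open>A variable receives each argument in both encodings, because its productions may use a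
  parameter in covariant and in invariant positions. The order of the two halves is that of
  \<open>split_params\<close>.\<close>

primrec up :: "'a trm \<Rightarrow> 'a trm" where
  "up (Par x) = Par (2 * x)"
| "up (App \<gamma> ts) = App (hat \<gamma>) (map up ts @ map exact ts)"

definition arg :: "'a \<Rightarrow> nat \<Rightarrow> 'a trm \<Rightarrow> 'a trm" where
  "arg \<gamma> i t = (if var \<Delta> \<gamma> i = Covariant then up t else exact t)"

definition rhs :: "'a \<Rightarrow> 'a trm list \<Rightarrow> 'a trm" where
  "rhs \<gamma> ts = App \<gamma> (map (\<lambda>i. arg \<gamma> i (ts ! i)) [0..<crank \<Delta> \<gamma>])"

lemma rhs_eq_App_iff:
  "App \<sigma> us = rhs \<gamma> ts \<longleftrightarrow> \<sigma> = \<gamma> \<and> us = map (\<lambda>i. arg \<gamma> i (ts ! i)) [0..<crank \<Delta> \<gamma>]"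
  by (auto simp: rhs_def)

text \<open>All ancestors are collected at once, the class itself included: a production puts a
  terminal at the root, after which no further inheritance step can be simulated there.\<close>

definition ancestors :: "('a \<times> 'a \<times> 'a trm list) set" where
  "ancestors = {(\<gamma>, \<gamma>', \<tau>s). inh_star \<Delta> \<gamma> (App \<gamma>' \<tau>s) \<and> \<gamma>' \<in> \<Sigma>}"

text \<open>The start variable needs rank 0. Its productions are those of
  \<open>hat \<gamma>\<^sub>0\<close> with the encodings of the ground arguments
  \<open>ts\<^sub>0\<close> already filled in.\<close>

definition G :: "'a tree_grammar" where
  "G = \<lparr>terminals = \<Sigma>, variables = insert v\<^sub>0 (insert dead (hat ` classes \<Delta>)),
     grank = (\<lambda>s. if s \<in> classes \<Delta> then crank \<Delta> s
       else if s \<in> hat ` classes \<Delta> then 2 * crank \<Delta> (inv_into (classes \<Delta>) hat s) else 0),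
     start = v\<^sub>0,
     productions =
       (\<lambda>(\<gamma>, \<gamma>', \<tau>s). (hat \<gamma>, split_params (params \<Delta> \<gamma>), rhs \<gamma>' \<tau>s)) ` ancestors \<union>
       (\<lambda>(\<gamma>, \<gamma>', \<tau>s). (v\<^sub>0, [], rhs \<gamma>' (map (inst (params \<Delta> \<gamma>\<^sub>0) ts\<^sub>0) \<tau>s))) ` {p \<in> ancestors. fst p = \<gamma>\<^sub>0}\<rparr>"

lemma G_simps [simp]:
  "terminals G = \<Sigma>" "variables G = insert v\<^sub>0 (insert dead (hat ` classes \<Delta>))" "start G = v\<^sub>0"
  by (simp_all add: G_def)

lemma grank_class [simp]: "\<gamma> \<in> classes \<Delta> \<Longrightarrow> grank G \<gamma> = crank \<Delta> \<gamma>"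
  by (simp add: G_def)

lemma grank_hat [simp]: "\<gamma> \<in> classes \<Delta> \<Longrightarrow> grank G (hat \<gamma>) = 2 * crank \<Delta> \<gamma>"
  using hat_fresh inj_hat by (auto simp: G_def)

lemma grank_nullary [simp]: "grank G v\<^sub>0 = 0" "grank G dead = 0"
  using v\<^sub>0_fresh dead_fresh by (auto simp: G_def)

lemma hat_eq_iff [simp]:
  assumes "\<gamma> \<in> classes \<Delta>"
  shows "\<gamma>' \<in> classes \<Delta> \<Longrightarrow> hat \<gamma> = hat \<gamma>' \<longleftrightarrow> \<gamma> = \<gamma>'"
    and "hat \<gamma> \<noteq> v\<^sub>0" "v\<^sub>0 \<noteq> hat \<gamma>" "hat \<gamma> \<noteq> dead" "dead \<noteq> hat \<gamma>"
  using assms inj_hat v\<^sub>0_fresh dead_fresh by (auto simp: inj_on_eq_iff)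

lemma ancestorsD:
  assumes "(\<gamma>, \<gamma>', \<tau>s) \<in> ancestors"
  shows "\<gamma> \<in> classes \<Delta>" "\<gamma>' \<in> \<Sigma>" "\<gamma>' \<in> classes \<Delta>"
    "App \<gamma>' \<tau>s \<in> terms (classes \<Delta>) (crank \<Delta>) (set (params \<Delta> \<gamma>))"
proof -
  have *: "inh_star \<Delta> \<gamma> (App \<gamma>' \<tau>s)" and "\<gamma>' \<in> \<Sigma>"
    using assms by (simp_all add: ancestors_def)
  then show "\<gamma> \<in> classes \<Delta>" "\<gamma>' \<in> \<Sigma>" "\<gamma>' \<in> classes \<Delta>"
    "App \<gamma>' \<tau>s \<in> terms (classes \<Delta>) (crank \<Delta>) (set (params \<Delta> \<gamma>))"
    using inh_star_in_terms[OF conformsD(1) *] by auto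
qed

lemma ancestors_unique:
  assumes "(\<gamma>, \<gamma>', \<tau>s) \<in> ancestors" "(\<gamma>, \<gamma>', \<tau>s') \<in> ancestors"
  shows "\<tau>s = \<tau>s'"
  using assms inh_star_unique[OF conformsD(1,2,4)] unfolding ancestors_def by blast

text \<open>By \<open>ancestors_unique\<close> an ancestor is determined by its pair of classes, and
  there are finitely many such pairs.\<close>

lemma finite_ancestors: "finite ancestors"
proof (rule finite_imageD)
  have "(\<lambda>(\<gamma>, \<gamma>', \<tau>s). (\<gamma>, \<gamma>')) ` ancestors \<subseteq> classes \<Delta> \<times> classes \<Delta>"
    using ancestorsD(1,3) by auto
  then show "finite ((\<lambda>(\<gamma>, \<gamma>', \<tau>s). (\<gamma>, \<gamma>')) ` ancestors)"
    using conformsD(1) finite_subset unfolding class_table_def by blast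
  show "inj_on (\<lambda>(\<gamma>, \<gamma>', \<tau>s). (\<gamma>, \<gamma>')) ancestors"
    by (rule inj_onI) (use ancestors_unique in auto)
qed

lemma in_productions_iff:
  "(v, xs, \<tau>) \<in> productions G \<longleftrightarrow>
     (\<exists>\<gamma> \<gamma>' \<tau>s. (\<gamma>, \<gamma>', \<tau>s) \<in> ancestors \<and> v = hat \<gamma> \<and> xs = split_params (params \<Delta> \<gamma>) \<and> \<tau> = rhs \<gamma>' \<tau>s) \<or>
     (\<exists>\<gamma>' \<tau>s. (\<gamma>\<^sub>0, \<gamma>', \<tau>s) \<in> ancestors \<and> v = v\<^sub>0 \<and> xs = [] \<and>
        \<tau> = rhs \<gamma>' (map (inst (params \<Delta> \<gamma>\<^sub>0) ts\<^sub>0) \<tau>s))"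
  by (force simp: G_def)

lemma hat_production_iff:
  assumes "\<gamma> \<in> classes \<Delta>"
  shows "(hat \<gamma>, xs, \<tau>) \<in> productions G \<longleftrightarrow> xs = split_params (params \<Delta> \<gamma>) \<and>
    (\<exists>\<gamma>' \<tau>s. (\<gamma>, \<gamma>', \<tau>s) \<in> ancestors \<and> \<tau> = rhs \<gamma>' \<tau>s)"
proof -
  have "\<gamma>' = \<gamma>" if "(\<gamma>', \<sigma>, \<tau>s) \<in> ancestors" "hat \<gamma> = hat \<gamma>'" for \<gamma>' \<sigma> \<tau>s
    using assms ancestorsD(1)[OF that(1)] that(2) by simp
  then show ?thesis
    unfolding in_productions_iff using hat_eq_iff(2)[OF assms] by metis
qed

lemma start_production_iff:
  "(v\<^sub>0, xs, \<tau>) \<in> productions G \<longleftrightarrow> xs = [] \<and>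
    (\<exists>\<gamma>' \<tau>s. (\<gamma>\<^sub>0, \<gamma>', \<tau>s) \<in> ancestors \<and> \<tau> = rhs \<gamma>' (map (inst (params \<Delta> \<gamma>\<^sub>0) ts\<^sub>0) \<tau>s))"
  unfolding in_productions_iff using ancestorsD(1) by auto

lemma dead_no_production: "(dead, xs, \<tau>) \<notin> productions G"
  unfolding in_productions_iff using ancestorsD(1) dead_fresh by auto

section \<open>The grammar is deterministic and in Greibach normal form\<close>

lemma exact_in_terms:
  assumes "t \<in> terms (classes \<Delta>) (crank \<Delta>) P"
  shows "exact t \<in> terms (terminals G \<union> variables G) (grank G) ((\<lambda>x. 2 * x + 1) ` P)"
  using assms by (induction t rule: trm.induct) auto

lemma up_in_terms:
  assumes "t \<in> terms (classes \<Delta>) (crank \<Delta>) P"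
  shows "up t \<in> terms (terminals G \<union> variables G) (grank G) ((\<lambda>x. 2 * x) ` P \<union> (\<lambda>x. 2 * x + 1) ` P)"
  using assms
proof (induction t rule: trm.induct)
  case (App \<gamma> ts)
  have "exact t \<in> terms (terminals G \<union> variables G) (grank G) ((\<lambda>x. 2 * x) ` P \<union> (\<lambda>x. 2 * x + 1) ` P)"
    if "t \<in> set ts" for t
    by (rule terms_mono[OF exact_in_terms[of t P]]) (use App.prems that in auto)
  then show ?case using App by auto
qed simp

lemma arg_in_terms:
  assumes "t \<in> terms (classes \<Delta>) (crank \<Delta>) (set xs)"
  shows "arg \<gamma> i t \<in> terms (terminals G \<union> variables G) (grank G) (set (split_params xs))"
proof -
  have "set (split_params xs) = (\<lambda>x. 2 * x) ` set xs \<union> (\<lambda>x. 2 * x + 1) ` set xs"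
    by (simp add: split_params_def)
  then show ?thesis
    using up_in_terms[OF assms] terms_mono[OF exact_in_terms[OF assms] subset_refl]
    by (simp add: arg_def)
qed

lemma rhs_in_terms:
  assumes "App \<gamma> ts \<in> terms (classes \<Delta>) (crank \<Delta>) (set xs)" "\<gamma> \<in> \<Sigma>"
  shows "\<exists>\<sigma> us. rhs \<gamma> ts = App \<sigma> us \<and> \<sigma> \<in> terminals G \<and> length us = grank G \<sigma> \<and>
    set us \<subseteq> terms (terminals G \<union> variables G) (grank G) (set (split_params xs))"
  using assms arg_in_terms[of _ xs \<gamma>] by (auto simp: rhs_def)

lemma gnf_G: "gnf_grammar G"
proof -
  have "v \<in> variables G \<and> length xs = grank G v \<and> distinct xs \<and>
      (\<exists>\<sigma> \<tau>s. \<tau> = App \<sigma> \<tau>s \<and> \<sigma> \<in> terminals G \<and> length \<tau>s = grank G \<sigma> \<and>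
         set \<tau>s \<subseteq> terms (terminals G \<union> variables G) (grank G) (set xs))"
    if "(v, xs, \<tau>) \<in> productions G" for v xs \<tau>
    using that unfolding in_productions_iff
  proof (elim disjE exE conjE)
    fix \<gamma> \<gamma>' \<tau>s
    assume a: "(\<gamma>, \<gamma>', \<tau>s) \<in> ancestors"
      and eq: "v = hat \<gamma>" "xs = split_params (params \<Delta> \<gamma>)" "\<tau> = rhs \<gamma>' \<tau>s"
    have "distinct (split_params (params \<Delta> \<gamma>))"
      using distinct_params[OF conformsD(1) ancestorsD(1)[OF a]]
      by (auto simp: split_params_def distinct_map inj_on_def, presburger)
    moreover have "length xs = grank G v"
      using ancestorsD(1)[OF a] by (simp add: eq split_params_def crank_eq_length_params)
    ultimately show ?thesis
      using rhs_in_terms[OF ancestorsD(4)[OF a] ancestorsD(2)[OF a]] ancestorsD(1)[OF a] eq by auto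
  next
    fix \<gamma>' \<tau>s
    assume a: "(\<gamma>\<^sub>0, \<gamma>', \<tau>s) \<in> ancestors"
      and eq: "v = v\<^sub>0" "xs = []" "\<tau> = rhs \<gamma>' (map (inst (params \<Delta> \<gamma>\<^sub>0) ts\<^sub>0) \<tau>s)"
    have "inst (params \<Delta> \<gamma>\<^sub>0) ts\<^sub>0 (App \<gamma>' \<tau>s) \<in> ground_types \<Delta>"
      by (rule inst_params_in_terms[OF ancestorsD(4)[OF a] bottom])
    then have "App \<gamma>' (map (inst (params \<Delta> \<gamma>\<^sub>0) ts\<^sub>0) \<tau>s) \<in> terms (classes \<Delta>) (crank \<Delta>) (set [])"
      by simp
    from rhs_in_terms[OF this ancestorsD(2)[OF a]] show ?thesis
      using eq by (auto simp: split_params_def)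
  qed
  moreover have "finite (productions G)"
    using finite_ancestors by (simp add: G_def)
  moreover have "finite (classes \<Delta>)" using conformsD(1) by (simp add: class_table_def)
  moreover have "\<Sigma> \<inter> variables G = {}"
    using tops hat_fresh v\<^sub>0_fresh dead_fresh by auto
  ultimately show ?thesis
    unfolding gnf_grammar_def using finite_subset[OF tops] by auto
qed

text \<open>The terminal at the root of a right-hand side is the ancestor class. Two productions
  that agree in variable and terminal thus come from the same pair of classes, and
  \<open>ancestors_unique\<close> applies.\<close>

lemma deterministic_G: "deterministic G"
  unfolding deterministic_def
proof (intro conjI allI impI)
  fix v xs xs' \<tau> \<tau>'
  assume "(v, xs, \<tau>) \<in> productions G" "(v, xs', \<tau>') \<in> productions G"
  then show "xs = xs'"
    unfolding in_productions_iff using ancestorsD(1) by auto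
next
  fix v xs \<sigma> \<tau>s \<tau>s'
  assume prods: "(v, xs, App \<sigma> \<tau>s) \<in> productions G" "(v, xs, App \<sigma> \<tau>s') \<in> productions G"
  show "\<tau>s = \<tau>s'"
  proof (cases "v = v\<^sub>0")
    case True
    with prods show ?thesis
      unfolding True start_production_iff rhs_eq_App_iff using ancestors_unique by blast
  next
    case False
    with prods(1) obtain \<gamma> where \<gamma>: "\<gamma> \<in> classes \<Delta>" "v = hat \<gamma>"
      unfolding in_productions_iff using ancestorsD(1) by blast
    from prods show ?thesis
      unfolding \<gamma>(2) hat_production_iff[OF \<gamma>(1)] rhs_eq_App_iff using ancestors_unique by blast
  qed
qed

section \<open>Derivations from the two encodings\<close>

sublocale deterministic_grammar G
  by unfold_locales (fact gnf_G deterministic_G)+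

text \<open>Substitution keeps the symbols above the parameters, so both sides are cut off to
  \<open>dead\<close> at the same places.\<close>

lemma exact_inst:
  assumes "length ts = length xs"
  shows "inst (split_params xs) (map up ts @ map exact ts) (exact t) = exact (inst xs ts t)"
proof (induction t)
  case (Par x)
  show ?case
    using map_of_split_params(2)[OF assms, of up exact x] by (simp add: inst_def split: option.split)
qed auto

lemma up_inst:
  assumes "length ts = length xs"
  shows "inst (split_params xs) (map up ts @ map exact ts) (up t) = up (inst xs ts t)"
proof (induction t)
  case (Par x)
  show ?case
    using map_of_split_params(1)[OF assms, of up exact x] by (simp add: inst_def split: option.split)
qed (use exact_inst[OF assms] in auto)

lemma arg_inst:
  assumes "length ts = length xs"
  shows "inst (split_params xs) (map up ts @ map exact ts) (arg \<gamma> i t) = arg \<gamma> i (inst xs ts t)"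
  using exact_inst[OF assms] up_inst[OF assms] by (simp add: arg_def)

lemma ground_top:
  assumes "t \<in> ground \<Sigma> (crank \<Delta>)"
  shows "t \<in> ground (terminals G \<union> variables G) (grank G)" "t \<in> ground_types \<Delta>"
proof -
  have "ground \<Sigma> (crank \<Delta>) = ground \<Sigma> (grank G)"
    using tops by (intro terms_rank_cong) auto
  with assms have "t \<in> ground \<Sigma> (grank G)" by simp
  then show "t \<in> ground (terminals G \<union> variables G) (grank G)"
    by (rule terms_mono) auto
  show "t \<in> ground_types \<Delta>" using terms_mono[OF assms tops] by simp
qed

lemma exact_ground:
  "t \<in> ground_types \<Delta> \<Longrightarrow> exact t \<in> ground (terminals G \<union> variables G) (grank G)"
  using exact_in_terms[of t "{}"] by simp

lemma up_ground:
  "t \<in> ground_types \<Delta> \<Longrightarrow> up t \<in> ground (terminals G \<union> variables G) (grank G)"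
  using up_in_terms[of t "{}"] by simp

text \<open>For a ground \<open>u\<close> the only variable that \<open>exact u\<close> can contain
  is \<open>dead\<close>. Either \<open>dead\<close> does not occur and \<open>exact u\<close> is
  \<open>u\<close>, or it occurs and blocks every terminal result.\<close>

lemma derives_exact_iff:
  assumes "t \<in> ground \<Sigma> (crank \<Delta>)" "u \<in> ground_types \<Delta>"
  shows "(derives G)\<^sup>*\<^sup>* (exact u) t \<longleftrightarrow> u = t"
  using assms
proof (induction t arbitrary: u rule: trm.induct)
  case (App \<sigma> ts)
  obtain \<gamma> us where u: "u = App \<gamma> us" using App.prems(2) by (cases u) auto
  have \<sigma>: "\<sigma> \<in> terminals G" using App.prems(1) by simp
  show ?case
  proof (cases "\<gamma> \<in> \<Sigma>")
    case True
    have "(derives G)\<^sup>*\<^sup>* (App \<gamma> (map exact us)) (App \<sigma> ts) \<longleftrightarrow> \<gamma> = \<sigma> \<and>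
        (\<forall>i < grank G \<gamma>. (derives G)\<^sup>*\<^sup>* (map exact us ! i) (ts ! i))"
      using True exact_ground[OF App.prems(2)] ground_top(1)[OF App.prems(1)] u
      by (intro derives_terminal_iff) auto
    also have "\<dots> \<longleftrightarrow> \<gamma> = \<sigma> \<and> (\<forall>i < length ts. us ! i = ts ! i)"
    proof (rule conj_cong[OF HOL.refl])
      assume eq: "\<gamma> = \<sigma>"
      then have len: "length us = length ts" "grank G \<gamma> = length ts"
        using App.prems u by auto
      have "(derives G)\<^sup>*\<^sup>* (exact (us ! i)) (ts ! i) \<longleftrightarrow> us ! i = ts ! i" if "i < length ts" for i
        using that len App.prems u by (intro App.IH) auto
      then show "(\<forall>i < grank G \<gamma>. (derives G)\<^sup>*\<^sup>* (map exact us ! i) (ts ! i)) \<longleftrightarrow>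
          (\<forall>i < length ts. us ! i = ts ! i)"
        using len by auto
    qed
    also have "\<dots> \<longleftrightarrow> u = App \<sigma> ts"
      using App.prems u by (auto intro: nth_equalityI)
    finally show ?thesis using True u by simp
  next
    case False
    have "\<not> (derives G)\<^sup>*\<^sup>* (App dead []) (App \<sigma> ts)"
      using \<sigma> ground_top(1)[OF App.prems(1)] dead_no_production
      by (subst derives_variable_iff) auto
    then show ?thesis using False u \<sigma> by auto
  qed
qed simp

text \<open>The common core of \<open>derives_up_iff\<close> and \<open>derives_start_iff\<close>.
  The claim about the arguments is an assumption, as the former supplies it by its induction and the
  latter by the finished \<open>derives_up_iff\<close>.\<close>

lemma subtype_iff_ancestor:
  assumes "App \<gamma> us \<in> ground_types \<Delta>" "App \<sigma> ts \<in> ground \<Sigma> (crank \<Delta>)"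
    and IH: "\<And>u t. t \<in> set ts \<Longrightarrow> u \<in> ground_types \<Delta> \<Longrightarrow> (derives G)\<^sup>*\<^sup>* (up u) t \<longleftrightarrow> subtype \<Delta> u t"
  shows "subtype \<Delta> (App \<gamma> us) (App \<sigma> ts) \<longleftrightarrow>
    (\<exists>\<tau>s. (\<gamma>, \<sigma>, \<tau>s) \<in> ancestors \<and>
      (\<forall>i < crank \<Delta> \<sigma>. (derives G)\<^sup>*\<^sup>* (arg \<sigma> i (inst (params \<Delta> \<gamma>) us (\<tau>s ! i))) (ts ! i)))"
proof -
  have iff: "(derives G)\<^sup>*\<^sup>* (arg \<sigma> i (inst (params \<Delta> \<gamma>) us (\<tau>s ! i))) (ts ! i) \<longleftrightarrow>
      (if var \<Delta> \<sigma> i = Covariant then subtype \<Delta> (inst (params \<Delta> \<gamma>) us (\<tau>s ! i)) (ts ! i)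
       else inst (params \<Delta> \<gamma>) us (\<tau>s ! i) = ts ! i)"
    if "(\<gamma>, \<sigma>, \<tau>s) \<in> ancestors" "i < crank \<Delta> \<sigma>" for \<tau>s i
  proof -
    have "inst (params \<Delta> \<gamma>) us (App \<sigma> \<tau>s) \<in> ground_types \<Delta>"
      by (rule inst_params_in_terms[OF ancestorsD(4)[OF that(1)] assms(1)])
    then have "inst (params \<Delta> \<gamma>) us (\<tau>s ! i) \<in> ground_types \<Delta>" using that(2) by auto
    moreover have "ts ! i \<in> set ts" "ts ! i \<in> ground \<Sigma> (crank \<Delta>)" using assms(2) that(2) by auto
    ultimately show ?thesis by (simp add: arg_def IH derives_exact_iff)
  qed
  have "\<sigma> \<in> \<Sigma>" using assms(2) by simp
  then show ?thesis
    unfolding subtype_iff_inh_star[OF conformsD(1,3) assms(1) ground_top(2)[OF assms(2)]]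
    using iff by (auto simp: ancestors_def)
qed

text \<open>The induction is on the target \<open>t\<close>: inheritance may be expansive, so the
  arguments that a production creates can be larger than \<open>u\<close>, while those of the target
  are smaller than \<open>t\<close>.\<close>

lemma derives_up_iff:
  assumes "t \<in> ground \<Sigma> (crank \<Delta>)" "u \<in> ground_types \<Delta>"
  shows "(derives G)\<^sup>*\<^sup>* (up u) t \<longleftrightarrow> subtype \<Delta> u t"
  using assms
proof (induction t arbitrary: u rule: trm.induct)
  case (App \<sigma> ts)
  obtain \<gamma> us where u: "u = App \<gamma> us" using App.prems(2) by (cases u) auto
  have \<gamma>: "\<gamma> \<in> classes \<Delta>" "length us = length (params \<Delta> \<gamma>)"
    using App.prems(2) u by (auto simp: crank_eq_length_params)
  have \<sigma>: "\<sigma> \<in> terminals G" "grank G \<sigma> = crank \<Delta> \<sigma>"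
    using App.prems(1) tops by auto
  have "(derives G)\<^sup>*\<^sup>* (up u) (App \<sigma> ts) \<longleftrightarrow>
    (\<exists>xs \<tau>s. (hat \<gamma>, xs, App \<sigma> \<tau>s) \<in> productions G \<and>
       (\<forall>i < grank G \<sigma>. (derives G)\<^sup>*\<^sup>* (inst xs (map up us @ map exact us) (\<tau>s ! i)) (ts ! i)))"
    unfolding u up.simps
    using \<gamma> \<sigma> up_ground[OF App.prems(2)] ground_top(1)[OF App.prems(1)] u
    by (intro derives_variable_iff) simp_all
  also have "\<dots> \<longleftrightarrow> (\<exists>\<tau>s. (\<gamma>, \<sigma>, \<tau>s) \<in> ancestors \<and>
      (\<forall>i < crank \<Delta> \<sigma>. (derives G)\<^sup>*\<^sup>* (arg \<sigma> i (inst (params \<Delta> \<gamma>) us (\<tau>s ! i))) (ts ! i)))"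
    unfolding hat_production_iff[OF \<gamma>(1)] rhs_eq_App_iff \<sigma>(2)
    by (auto simp: arg_inst[OF \<gamma>(2)])
  also have "\<dots> \<longleftrightarrow> subtype \<Delta> (App \<gamma> us) (App \<sigma> ts)"
    using App.prems App.IH u by (intro subtype_iff_ancestor[symmetric]) auto
  finally show ?case by (simp add: u)
qed simp

lemma derives_start_iff:
  assumes "t \<in> ground \<Sigma> (crank \<Delta>)"
  shows "(derives G)\<^sup>*\<^sup>* (App v\<^sub>0 []) t \<longleftrightarrow> subtype \<Delta> (App \<gamma>\<^sub>0 ts\<^sub>0) t"
proof -
  obtain \<sigma> ts where t: "t = App \<sigma> ts" using assms by (cases t) auto
  have \<sigma>: "\<sigma> \<in> terminals G" "grank G \<sigma> = crank \<Delta> \<sigma>"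
    using assms tops t by auto
  have "(derives G)\<^sup>*\<^sup>* (App v\<^sub>0 []) (App \<sigma> ts) \<longleftrightarrow>
    (\<exists>xs \<tau>s. (v\<^sub>0, xs, App \<sigma> \<tau>s) \<in> productions G \<and>
       (\<forall>i < grank G \<sigma>. (derives G)\<^sup>*\<^sup>* (inst xs [] (\<tau>s ! i)) (ts ! i)))"
    using \<sigma> ground_top(1)[OF assms] t by (intro derives_variable_iff) simp_all
  also have "\<dots> \<longleftrightarrow> (\<exists>\<tau>s. (\<gamma>\<^sub>0, \<sigma>, \<tau>s) \<in> ancestors \<and>
      (\<forall>i < crank \<Delta> \<sigma>. (derives G)\<^sup>*\<^sup>* (arg \<sigma> i (inst (params \<Delta> \<gamma>\<^sub>0) ts\<^sub>0 (\<tau>s ! i))) (ts ! i)))"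
  proof -
    let ?I = "inst (params \<Delta> \<gamma>\<^sub>0) ts\<^sub>0"
    \<comment> \<open>Since \<open>i\<close> stays below the length of \<open>\<tau>s\<close>,
      picking an argument commutes with filling in \<open>ts\<^sub>0\<close>. The productions of the
      start variable then have the form that \<open>subtype_iff_ancestor\<close> expects.\<close>
    have "length \<tau>s = crank \<Delta> \<sigma>" if "(\<gamma>\<^sub>0, \<sigma>, \<tau>s) \<in> ancestors" for \<tau>s
      using ancestorsD(4)[OF that] by simp
    then have "map (\<lambda>i. arg \<sigma> i (map ?I \<tau>s ! i)) [0..<crank \<Delta> \<sigma>] =
        map (\<lambda>i. arg \<sigma> i (?I (\<tau>s ! i))) [0..<crank \<Delta> \<sigma>]"
      if "(\<gamma>\<^sub>0, \<sigma>, \<tau>s) \<in> ancestors" for \<tau>s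
      using that by simp
    then have "(v\<^sub>0, xs, App \<sigma> us) \<in> productions G \<longleftrightarrow> xs = [] \<and> (\<exists>\<tau>s. (\<gamma>\<^sub>0, \<sigma>, \<tau>s) \<in> ancestors \<and>
        us = map (\<lambda>i. arg \<sigma> i (?I (\<tau>s ! i))) [0..<crank \<Delta> \<sigma>])" for xs us
      unfolding start_production_iff rhs_eq_App_iff by (metis (no_types))
    then show ?thesis
      unfolding \<sigma>(2) by auto
  qed
  also have "\<dots> \<longleftrightarrow> subtype \<Delta> (App \<gamma>\<^sub>0 ts\<^sub>0) (App \<sigma> ts)"
  proof (rule subtype_iff_ancestor[symmetric, OF bottom])
    show "App \<sigma> ts \<in> ground \<Sigma> (crank \<Delta>)" using assms t by simp
    then show "(derives G)\<^sup>*\<^sup>* (up u) t \<longleftrightarrow> subtype \<Delta> u t"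
      if "t \<in> set ts" "u \<in> ground_types \<Delta>" for u t
      using that by (intro derives_up_iff) auto
  qed
  finally show ?thesis by (simp add: t)
qed

lemma table_forest_eq: "table_forest \<Delta> (App \<gamma>\<^sub>0 ts\<^sub>0) \<Sigma> = grammar_forest G"
proof -
  have "ground \<Sigma> (crank \<Delta>) = ground \<Sigma> (grank G)"
    using tops by (intro terms_rank_cong) auto
  then show ?thesis
    using derives_start_iff by (auto simp: table_forest_def grammar_forest_def)
qed

end

section \<open>Choice of fresh symbols and equality of the two classes of forests\<close>

lemma table_forest_in_DCF:
  fixes \<Delta> :: "'a class_table"
  assumes "infinite (UNIV :: 'a set)" "conforms_TX \<Delta>" "t \<in> ground_types \<Delta>" "\<Sigma> \<subseteq> classes \<Delta>"
  shows "table_forest \<Delta> t \<Sigma> \<in> DCF"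
proof -
  let ?C = "classes \<Delta>"
  have fin: "finite ?C" using assms(2) by (simp add: conforms_TX_def class_table_def)
  \<comment> \<open>Infinitely many symbols lie outside the finite set of classes. A subset of them
    with as many elements as there are classes serves as the range of \<open>hat\<close>.\<close>
  have "infinite (- ?C)" using fin assms(1) by (simp add: Compl_eq_Diff_UNIV)
  then obtain B where B: "finite B" "card B = card ?C" "B \<subseteq> - ?C"
    using infinite_arbitrarily_large by blast
  then obtain hat where hat: "bij_betw hat ?C B"
    using fin finite_same_card_bij by metis
  obtain v\<^sub>0 where v\<^sub>0: "v\<^sub>0 \<notin> ?C \<union> B"
    using ex_new_if_finite[OF assms(1)] fin B(1) by (metis finite_UnI)
  obtain dead where dead: "dead \<notin> insert v\<^sub>0 (?C \<union> B)"
    using ex_new_if_finite[OF assms(1)] fin B(1) by (metis finite_UnI finite_insert)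
  obtain \<gamma>\<^sub>0 ts\<^sub>0 where t: "t = App \<gamma>\<^sub>0 ts\<^sub>0" using assms(3) by (cases t) auto
  interpret table_to_grammar \<Delta> \<gamma>\<^sub>0 ts\<^sub>0 \<Sigma> hat v\<^sub>0 dead
    using assms t B(3) v\<^sub>0 dead bij_betw_imp_inj_on[OF hat] bij_betw_imp_surj_on[OF hat]
    by unfold_locales auto
  show ?thesis
    unfolding DCF_def using table_forest_eq gnf_G deterministic_G t by blast
qed

theorem proposition5p8:
  assumes "infinite (UNIV :: 'a set)"
  shows "(TX_forests :: 'a trm set set) = DCF"
proof
  show "(TX_forests :: 'a trm set set) \<subseteq> DCF"
    unfolding TX_forests_def using table_forest_in_DCF[OF assms] by blast
  show "(DCF :: 'a trm set set) \<subseteq> TX_forests"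
    unfolding DCF_def
    using deterministic_grammar.grammar_forest_in_TX deterministic_grammar.intro by blast
qed

end
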